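(* Let $M$ be a paracompact smooth ($C^\infty$) manifold of dimension $n$, let $\mathbb{D}=\{a+\varepsilon b: a,b\in\mathbb{R},\ \varepsilon^2=0\}$ be the algebra of dual numbers, and identify the Weil bundle $M^{\mathbb{D}}$ with the tangent bundle $TM$. Then the canonical foliation on $TM$, i.e. the foliation defined by the vector fields $d^*$ induced on $TM=M^{\mathbb{D}}$ by a basis of the space $\mathrm{Der}(\mathbb{D})$ of derivations of $\mathbb{D}$, is the foliation defined by the canonical vector field (Liouville field) $C$ of $TM$.
   Context: For a local algebra $A$ in the sense of Weil (a real commutative unital finite-dimensional algebra with a unique maximal ideal $\mathfrak{m}$, of codimension $1$, so $A=\mathbb{R}\oplus\mathfrak{m}$), the Weil bundle $M^A=\mathrm{Hom}_{\mathrm{Alg}}(C^\infty(M),A)$ is the smooth manifold of algebra homomorphisms $\xi:C^\infty(M)\to A$ (each is near to a unique $p\in M$, in the sense that $\xi(f)-f(p)\in\mathfrak{m}$ for all $f$). For $f\in C^\infty(M)$, define $f^A\in C^\infty(M^A,A)$ by $f^A(\xi)=\xi(f)$. Vector fields on $M^A$ are regarded as derivations of $C^\infty(M)$ into $C^\infty(M^A,A)$, that is, $\mathbb{R}$-linear maps $X:C^\infty(M)\to C^\infty(M^A,A)$ with $X(fg)=X(f)\cdot g^A+f^A\cdot X(g)$. An ordinary vector field (derivation $Y$ of $C^\infty(M^A)$) corresponds bijectively to the derivation $f\mapsto\sum_i a_i\,Y(a_i^*\circ f^A)$, where $(a_i)$ is a basis of $A$ with dual basis $(a_i^* )$. For a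 derivation $d$ of $A$, the induced vector field $d^*$ on $M^A$ is the derivation $f\mapsto(-d)\circ f^A$. If $d_1,\dots,d_r$ is a basis of $\mathrm{Der}(A)$, the canonical foliation on $M^A$ is the one defined by the differential system generated by $d_1^*,\dots,d_r^*$. For $A=\mathbb{D}$, the manifold $M^{\mathbb{D}}$ is identified with $TM$: a tangent vector $v\in T_pM$ corresponds to the homomorphism $f\mapsto f(p)+\varepsilon\, v(f)$, so $f^{\mathbb{D}}(v)=f(p)+\varepsilon\, v(f)$. The Liouville field $C$ on $TM$ is the vector field given in local coordinates $(x_1,\dots,x_n)$ on $M$, with fibre coordinates $y_i=dx_i$, by $C=\sum_{i=1}^n y_i\,\frac{\partial}{\partial y_i}$. The foliation defined by $C$ is the one defined by the differential system generated by $C$. *)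

theory Defs
  imports "HOL-Analysis.Analysis"
begin

section \<open>Smooth functions on open subsets of Euclidean space\<close>

text \<open>
  Points of the \<open>n\<close>-dimensional space are sequences vanishing from index \<open>n\<close> on (the library's
  \<^const>\<open>Euclidean_space\<close>), so that \<open>n\<close> may be any natural number, zero included, and different
  dimensions (of a manifold, its tangent bundle, and the leaves of a foliation) can occur together.
\<close>

definition partial_deriv :: "nat \<Rightarrow> ((nat \<Rightarrow> real) \<Rightarrow> real) \<Rightarrow> (nat \<Rightarrow> real) \<Rightarrow> real" where
  "partial_deriv i f x = deriv (\<lambda>t. f (x(i := t))) (x i)"

fun Ck_on :: "nat \<Rightarrow> nat \<Rightarrow> (nat \<Rightarrow> real) set \<Rightarrow> ((nat \<Rightarrow> real) \<Rightarrow> real) \<Rightarrow> bool" where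
  "Ck_on 0 n V f \<longleftrightarrow> continuous_map (subtopology (Euclidean_space n) V) euclideanreal f"
| "Ck_on (Suc k) n V f \<longleftrightarrow>
     continuous_map (subtopology (Euclidean_space n) V) euclideanreal f \<and>
     (\<forall>i<n. (\<forall>x\<in>V. (\<lambda>t. f (x(i := t))) field_differentiable at (x i)) \<and>
            Ck_on k n V (partial_deriv i f))"

definition smooth_on :: "nat \<Rightarrow> (nat \<Rightarrow> real) set \<Rightarrow> ((nat \<Rightarrow> real) \<Rightarrow> real) \<Rightarrow> bool" where
  "smooth_on n V f \<longleftrightarrow> (\<forall>k. Ck_on k n V f)"

lemma Euclidean_space_upd:
  assumes V: "openin (Euclidean_space n) V" "x \<in> V" "i < n"
  shows "\<forall>\<^sub>F t in nhds (x i). x(i := t) \<in> V"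
proof -
  have x: "x \<in> topspace (Euclidean_space n)"
    using V openin_subset by blast
  have "continuous_map euclideanreal (Euclidean_space n) (\<lambda>t. x(i := t))"
    unfolding Euclidean_space_def continuous_map_in_subtopology continuous_map_componentwise_UNIV
    using x V(3) by (auto simp: topspace_Euclidean_space fun_upd_def)
  then have "openin euclideanreal {t \<in> topspace euclideanreal. x(i := t) \<in> V}"
    using V(1) by (rule openin_continuous_map_preimage)
  then have "open {t. x(i := t) \<in> V}" by simp
  then show ?thesis
    using V(2) by (auto simp: eventually_nhds)
qed

lemma partial_deriv_cong:
  assumes "openin (Euclidean_space n) V" "\<And>x. x \<in> V \<Longrightarrow> f x = g x" "x \<in> V" "i < n"
  shows "partial_deriv i f x = partial_deriv i g x"
proof -
  have "\<forall>\<^sub>F t in nhds (x i). f (x(i := t)) = g (x(i := t))"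
    using Euclidean_space_upd[OF assms(1,3,4)] by eventually_elim (rule assms(2))
  then show ?thesis
    unfolding partial_deriv_def by (rule deriv_cong_ev) simp
qed

lemma Ck_on_cong:
  assumes "openin (Euclidean_space n) V" "\<And>x. x \<in> V \<Longrightarrow> f x = g x" "Ck_on k n V f"
  shows "Ck_on k n V g"
  using assms(2,3)
proof (induction k arbitrary: f g)
  case 0
  then show ?case
    using assms(1) by (auto elim!: continuous_map_eq)
next
  case (Suc k)
  have diff: "(\<lambda>t. g (x(i := t))) field_differentiable at (x i)" if "x \<in> V" "i < n" for x i
  proof -
    have "\<forall>\<^sub>F t in nhds (x i). f (x(i := t)) = g (x(i := t))"
      using Euclidean_space_upd[OF assms(1) that] by eventually_elim (rule Suc.prems(1))
    moreover have "(\<lambda>t. f (x(i := t))) field_differentiable at (x i)"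
      using Suc.prems(2) that by simp
    ultimately show ?thesis
      unfolding field_differentiable_def by (metis DERIV_cong_ev)
  qed
  have "Ck_on k n V (partial_deriv i g)" if "i < n" for i
    using Suc.IH[of "partial_deriv i f" "partial_deriv i g"] Suc.prems that
      partial_deriv_cong[OF assms(1), of f g] by simp
  moreover have "continuous_map (subtopology (Euclidean_space n) V) euclideanreal g"
    using Suc.prems by (auto elim!: continuous_map_eq)
  ultimately show ?case
    using diff by simp
qed

lemma Ck_on_Suc_D: "Ck_on (Suc k) n V f \<Longrightarrow> Ck_on k n V f"
proof (induction k arbitrary: f)
  case (Suc k)
  then show ?case by (subst Ck_on.simps) (simp del: Ck_on.simps add: Ck_on.simps(2)[of "Suc k"])
qed simp

lemma Ck_on_const: "Ck_on k n V (\<lambda>x. c)"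
proof (induction k arbitrary: c)
  case (Suc k)
  have "partial_deriv i (\<lambda>x. c) = (\<lambda>x. 0)" for i
    by (simp add: partial_deriv_def fun_eq_iff)
  then show ?case
    using Suc by simp
qed simp

lemma Ck_on_add:
  assumes "openin (Euclidean_space n) V" "Ck_on k n V f" "Ck_on k n V g"
  shows "Ck_on k n V (\<lambda>x. f x + g x)"
  using assms(2,3)
proof (induction k arbitrary: f g)
  case 0
  then show ?case by (simp add: continuous_map_add)
next
  case (Suc k)
  have "Ck_on k n V (partial_deriv i (\<lambda>x. f x + g x))" if "i < n" for i
  proof (rule Ck_on_cong[OF assms(1)])
    show "Ck_on k n V (\<lambda>x. partial_deriv i f x + partial_deriv i g x)"
      using Suc that by simp
  qed (use Suc.prems that in \<open>simp add: partial_deriv_def\<close>)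
  then show ?case
    using Suc.prems by (auto intro!: continuous_map_add field_differentiable_add)
qed

lemma Ck_on_mult:
  assumes "openin (Euclidean_space n) V" "Ck_on k n V f" "Ck_on k n V g"
  shows "Ck_on k n V (\<lambda>x. f x * g x)"
  using assms(2,3)
proof (induction k arbitrary: f g)
  case 0
  then show ?case by (simp add: continuous_map_real_mult)
next
  case (Suc k)
  have "Ck_on k n V (partial_deriv i (\<lambda>x. f x * g x))" if "i < n" for i
  proof (rule Ck_on_cong[OF assms(1)])
    show "Ck_on k n V (\<lambda>x. f x * partial_deriv i g x + partial_deriv i f x * g x)"
      using Suc that Ck_on_Suc_D[OF Suc.prems(1)] Ck_on_Suc_D[OF Suc.prems(2)]
      by (intro Ck_on_add[OF assms(1)] Suc.IH) simp_all
  qed (use Suc.prems that in \<open>simp add: partial_deriv_def\<close>)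
  then show ?case
    using Suc.prems by (auto intro!: continuous_map_real_mult field_differentiable_mult)
qed

section \<open>Smooth manifolds\<close>

record 'a manifold =
  mtop :: "'a topology"
  mdim :: nat
  atlas :: "('a set \<times> ('a \<Rightarrow> nat \<Rightarrow> real)) set"

abbreviation mcarrier :: "'a manifold \<Rightarrow> 'a set" where
  "mcarrier M \<equiv> topspace (mtop M)"

definition smooth_manifold :: "'a manifold \<Rightarrow> bool" where
  "smooth_manifold M \<longleftrightarrow>
     Hausdorff_space (mtop M) \<and>
     (\<Union>(U, \<phi>)\<in>atlas M. U) = mcarrier M \<and>
     (\<forall>(U, \<phi>)\<in>atlas M.
        openin (mtop M) U \<and> openin (Euclidean_space (mdim M)) (\<phi> ` U) \<and>
        homeomorphic_map (subtopology (mtop M) U)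
          (subtopology (Euclidean_space (mdim M)) (\<phi> ` U)) \<phi>) \<and>
     (\<forall>(U, \<phi>)\<in>atlas M. \<forall>(V, \<psi>)\<in>atlas M. \<forall>i<mdim M.
        smooth_on (mdim M) (\<phi> ` (U \<inter> V)) (\<lambda>x. \<psi> (inv_into U \<phi> x) i))"

definition paracompact_space :: "'a topology \<Rightarrow> bool" where
  "paracompact_space X \<longleftrightarrow>
     (\<forall>\<U>. (\<forall>U\<in>\<U>. openin X U) \<and> \<Union>\<U> = topspace X \<longrightarrow>
        (\<exists>\<V>. (\<forall>V\<in>\<V>. openin X V \<and> (\<exists>U\<in>\<U>. V \<subseteq> U)) \<and> \<Union>\<V> = topspace X \<and>
             locally_finite_in X \<V>))"

text \<open>
  A function on the carrier is represented by the total function that vanishes off the carrier;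
  thus equality of total functions is equality on the carrier, and the algebra operations are
  pointwise. Likewise for operators on the algebra of smooth functions.
\<close>

definition Cinf :: "'a manifold \<Rightarrow> ('a \<Rightarrow> real) set" where
  "Cinf M = {f. (\<forall>p. p \<notin> mcarrier M \<longrightarrow> f p = 0) \<and>
     (\<forall>(U, \<phi>)\<in>atlas M. smooth_on (mdim M) (\<phi> ` U) (\<lambda>x. f (inv_into U \<phi> x)))}"

abbreviation unit_fun :: "'a manifold \<Rightarrow> 'a \<Rightarrow> real" where
  "unit_fun M \<equiv> indicator (mcarrier M)"

lemma Cinf_0: "f \<in> Cinf M \<Longrightarrow> p \<notin> mcarrier M \<Longrightarrow> f p = 0"
  by (simp add: Cinf_def)

context
  fixes M :: "'a manifold"
  assumes M: "smooth_manifold M"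
begin

lemma Cinf_chart:
  assumes "(U, \<phi>) \<in> atlas M"
  shows "openin (Euclidean_space (mdim M)) (\<phi> ` U)" "U \<subseteq> mcarrier M"
  using M assms unfolding smooth_manifold_def by (blast, blast)

lemma Cinf_scaled_unit: "(\<lambda>q. c * unit_fun M q) \<in> Cinf M"
proof -
  have "smooth_on (mdim M) (\<phi> ` U) (\<lambda>x. c * unit_fun M (inv_into U \<phi> x))"
    if "(U, \<phi>) \<in> atlas M" for U \<phi>
    unfolding smooth_on_def
  proof
    fix k
    have "c = c * unit_fun M (inv_into U \<phi> x)" if "x \<in> \<phi> ` U" for x
      using inv_into_into[OF that] Cinf_chart(2)[OF \<open>(U, \<phi>) \<in> atlas M\<close>] by (auto simp: subset_iff)
    then show "Ck_on k (mdim M) (\<phi> ` U) (\<lambda>x. c * unit_fun M (inv_into U \<phi> x))"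
      by (rule Ck_on_cong[OF Cinf_chart(1)[OF that] _ Ck_on_const])
  qed
  then show ?thesis by (auto simp: Cinf_def)
qed

lemma unit_fun_Cinf: "unit_fun M \<in> Cinf M"
  using Cinf_scaled_unit[of 1] by simp

lemma Cinf_add: "f \<in> Cinf M \<Longrightarrow> g \<in> Cinf M \<Longrightarrow> (\<lambda>q. f q + g q) \<in> Cinf M"
  by (fastforce simp: Cinf_def smooth_on_def intro!: Ck_on_add Cinf_chart)

lemma Cinf_mult: "f \<in> Cinf M \<Longrightarrow> g \<in> Cinf M \<Longrightarrow> (\<lambda>q. f q * g q) \<in> Cinf M"
  by (fastforce simp: Cinf_def smooth_on_def intro!: Ck_on_mult Cinf_chart)

lemma Cinf_cmult:
  assumes "f \<in> Cinf M"
  shows "(\<lambda>q. c * f q) \<in> Cinf M"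
proof -
  have "(\<lambda>q. (c * unit_fun M q) * f q) \<in> Cinf M"
    by (rule Cinf_mult[OF Cinf_scaled_unit assms])
  moreover have "(\<lambda>q. (c * unit_fun M q) * f q) = (\<lambda>q. c * f q)"
  proof
    show "(c * unit_fun M q) * f q = c * f q" for q
      by (cases "q \<in> mcarrier M") (simp_all add: Cinf_0[OF assms])
  qed
  ultimately show ?thesis by simp
qed

end

definition tangent_space :: "'a manifold \<Rightarrow> 'a \<Rightarrow> (('a \<Rightarrow> real) \<Rightarrow> real) set" where
  "tangent_space M p = {v.
     (\<forall>f\<in>Cinf M. \<forall>g\<in>Cinf M. v (\<lambda>q. f q + g q) = v f + v g) \<and>
     (\<forall>c. \<forall>f\<in>Cinf M. v (\<lambda>q. c * f q) = c * v f) \<and>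
     (\<forall>f\<in>Cinf M. \<forall>g\<in>Cinf M. v (\<lambda>q. f q * g q) = v f * g p + f p * v g) \<and>
     (\<forall>f. f \<notin> Cinf M \<longrightarrow> v f = 0)}"

definition smooth_map :: "'a manifold \<Rightarrow> 'b manifold \<Rightarrow> ('a \<Rightarrow> 'b) \<Rightarrow> bool" where
  "smooth_map L N F \<longleftrightarrow>
     continuous_map (mtop L) (mtop N) F \<and>
     (\<forall>(U, \<phi>)\<in>atlas L. \<forall>(V, \<psi>)\<in>atlas N. \<forall>i<mdim N.
        smooth_on (mdim L) (\<phi> ` {p \<in> U. F p \<in> V}) (\<lambda>x. \<psi> (F (inv_into U \<phi> x)) i))"

definition tangent_map ::
  "'a manifold \<Rightarrow> 'b manifold \<Rightarrow> ('a \<Rightarrow> 'b) \<Rightarrow> (('a \<Rightarrow> real) \<Rightarrow> real) \<Rightarrow> ('b \<Rightarrow> real) \<Rightarrow> real" where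
  "tangent_map L N F v =
     (\<lambda>g. if g \<in> Cinf N then v (\<lambda>p. if p \<in> mcarrier L then g (F p) else 0) else 0)"

subsection \<open>The tangent bundle\<close>

text \<open>
  A tangent vector acts on functions that are smooth only near its base point, such as
  coordinate functions, through any global smooth function with the same germ.
\<close>

definition germ_apply ::
  "'a manifold \<Rightarrow> 'a \<times> (('a \<Rightarrow> real) \<Rightarrow> real) \<Rightarrow> ('a \<Rightarrow> real) \<Rightarrow> real" where
  "germ_apply M = (\<lambda>(p, v) g.
     v (SOME f. f \<in> Cinf M \<and> (\<exists>W. openin (mtop M) W \<and> p \<in> W \<and> (\<forall>q\<in>W. f q = g q))))"

definition tangent_vectors :: "'a manifold \<Rightarrow> ('a \<times> (('a \<Rightarrow> real) \<Rightarrow> real)) set" where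
  "tangent_vectors M = (SIGMA p : mcarrier M. tangent_space M p)"

text \<open>
  The chart with coordinates \<open>x\<^sub>0, \<dots>, x\<^sub>n\<^sub>-\<^sub>1, y\<^sub>0, \<dots>, y\<^sub>n\<^sub>-\<^sub>1\<close>, in this order, where
  \<open>y\<^sub>i(v) = dx\<^sub>i(v) = v(x\<^sub>i)\<close>.
\<close>

definition tangent_chart ::
  "'a manifold \<Rightarrow> 'a set \<times> ('a \<Rightarrow> nat \<Rightarrow> real) \<Rightarrow>
    ('a \<times> (('a \<Rightarrow> real) \<Rightarrow> real)) set \<times> ('a \<times> (('a \<Rightarrow> real) \<Rightarrow> real) \<Rightarrow> nat \<Rightarrow> real)" where
  "tangent_chart M = (\<lambda>(U, \<phi>).
     ({\<xi> \<in> tangent_vectors M. fst \<xi> \<in> U},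
      \<lambda>\<xi> i. if i < mdim M then \<phi> (fst \<xi>) i
            else if i < 2 * mdim M then germ_apply M \<xi> (\<lambda>q. \<phi> q (i - mdim M))
            else 0))"

definition tangent_bundle :: "'a manifold \<Rightarrow> ('a \<times> (('a \<Rightarrow> real) \<Rightarrow> real)) manifold" where
  "tangent_bundle M =
     \<lparr> mtop = topology_generated_by
         {{\<xi> \<in> W. \<Phi> \<xi> \<in> Q} | W \<Phi> Q.
            (W, \<Phi>) \<in> tangent_chart M ` atlas M \<and> openin (Euclidean_space (2 * mdim M)) Q},
       mdim = 2 * mdim M,
       atlas = tangent_chart M ` atlas M \<rparr>"

text \<open>
  The Liouville field as an operator on smooth functions on the tangent bundle; the value of
  \<open>\<Sum>i. y\<^sub>i \<partial>/\<partial>y\<^sub>i\<close> does not depend on the chart around the base point.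
\<close>

definition liouville_field ::
  "'a manifold \<Rightarrow> ('a \<times> (('a \<Rightarrow> real) \<Rightarrow> real) \<Rightarrow> real) \<Rightarrow> 'a \<times> (('a \<Rightarrow> real) \<Rightarrow> real) \<Rightarrow> real" where
  "liouville_field M g \<xi> =
     (if g \<in> Cinf (tangent_bundle M) \<and> \<xi> \<in> tangent_vectors M
      then (let (W, \<Phi>) = tangent_chart M (SOME c. c \<in> atlas M \<and> fst \<xi> \<in> fst c);
                n = mdim M
            in \<Sum>i<n. \<Phi> \<xi> (n + i) * partial_deriv (n + i) (\<lambda>z. g (inv_into W \<Phi> z)) (\<Phi> \<xi>))
      else 0)"

section \<open>Foliations with singularities\<close>

text \<open>
  \<open>\<Delta>\<close> assigns to each point a set of tangent vectors; the dimension is allowed to vary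
  from point to point. Integral manifolds are connected immersed submanifolds \<open>L\<close>
  (with their own topology and smooth structure) having \<open>\<Delta>\<close> as tangent spaces, and the
  foliation defined by \<open>\<Delta>\<close> consists of the maximal ones, its leaves.
\<close>

definition integral_manifold ::
  "'a manifold \<Rightarrow> ('a \<Rightarrow> (('a \<Rightarrow> real) \<Rightarrow> real) set) \<Rightarrow> 'a manifold \<Rightarrow> bool" where
  "integral_manifold N \<Delta> L \<longleftrightarrow>
     smooth_manifold L \<and> connected_space (mtop L) \<and> mcarrier L \<noteq> {} \<and>
     mcarrier L \<subseteq> mcarrier N \<and> smooth_map L N (\<lambda>p. p) \<and>
     (\<forall>p\<in>mcarrier L.
        inj_on (tangent_map L N (\<lambda>p. p)) (tangent_space L p) \<and>
        tangent_map L N (\<lambda>p. p) ` tangent_space L p = \<Delta> p)"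

definition leaves :: "'a manifold \<Rightarrow> ('a \<Rightarrow> (('a \<Rightarrow> real) \<Rightarrow> real) set) \<Rightarrow> 'a set set" where
  "leaves N \<Delta> =
     {mcarrier L | L. integral_manifold N \<Delta> L \<and>
        (\<forall>L'. integral_manifold N \<Delta> L' \<and> mcarrier L \<subseteq> mcarrier L' \<longrightarrow> mcarrier L' = mcarrier L)}"

section \<open>Weil bundles and dual numbers\<close>

subsection \<open>Derivations of an algebra\<close>

definition derivations :: "('w::real_algebra_1 \<Rightarrow> 'w) set" where
  "derivations = {d. linear d \<and> (\<forall>a b. d (a * b) = d a * b + a * d b)}"

definition derivation_basis :: "nat \<Rightarrow> (nat \<Rightarrow> 'w::real_algebra_1 \<Rightarrow> 'w) \<Rightarrow> bool" where
  "derivation_basis r d \<longleftrightarrow>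
     (\<forall>i<r. d i \<in> derivations) \<and>
     (\<forall>c. (\<forall>a. (\<Sum>i<r. c i *\<^sub>R d i a) = 0) \<longrightarrow> (\<forall>i<r. c i = 0)) \<and>
     (\<forall>\<delta>\<in>derivations. \<exists>c. \<forall>a. \<delta> a = (\<Sum>i<r. c i *\<^sub>R d i a))"

subsection \<open>The dual numbers\<close>

datatype dual = Dual (re_part: real) (eps_part: real)

instantiation dual :: "{comm_ring_1, real_algebra_1}"
begin

definition "0 = Dual 0 0"
definition "1 = Dual 1 0"
definition "x + y = Dual (re_part x + re_part y) (eps_part x + eps_part y)"
definition "x - y = Dual (re_part x - re_part y) (eps_part x - eps_part y)"
definition "- x = Dual (- re_part x) (- eps_part x)"
definition "x * y = Dual (re_part x * re_part y) (re_part x * eps_part y + eps_part x * re_part y)"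
definition "c *\<^sub>R x = Dual (c * re_part x) (c * eps_part x)"

instance
  by standard
    (auto simp: zero_dual_def one_dual_def plus_dual_def minus_dual_def uminus_dual_def
      times_dual_def scaleR_dual_def algebra_simps)

end

lemma dual_dvd_1: "a dvd (1::dual) \<longleftrightarrow> re_part a \<noteq> 0"
proof
  assume "a dvd 1"
  then show "re_part a \<noteq> 0"
    by (auto simp: dvd_def one_dual_def times_dual_def)
next
  assume "re_part a \<noteq> 0"
  then have "1 = a * Dual (1 / re_part a) (- eps_part a / (re_part a)\<^sup>2)"
    by (simp add: one_dual_def times_dual_def power2_eq_square)
  then show "a dvd 1" by (metis dvd_triv_left)
qed

subsection \<open>Weil bundles\<close>

text \<open>
  For a local algebra the maximal ideal is the set of non-units. A homomorphism belongs to the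
  Weil bundle if it is near to some point of the manifold.
\<close>

definition near_to :: "'a manifold \<Rightarrow> 'a \<Rightarrow> (('a \<Rightarrow> real) \<Rightarrow> 'w::{comm_ring_1,real_algebra_1}) \<Rightarrow> bool" where
  "near_to M p \<xi> \<longleftrightarrow> (\<forall>f\<in>Cinf M. \<not> (\<xi> f - of_real (f p)) dvd 1)"

definition weil_bundle :: "'a manifold \<Rightarrow> (('a \<Rightarrow> real) \<Rightarrow> 'w::{comm_ring_1,real_algebra_1}) set" where
  "weil_bundle M = {\<xi>.
     (\<forall>f\<in>Cinf M. \<forall>g\<in>Cinf M. \<xi> (\<lambda>q. f q + g q) = \<xi> f + \<xi> g) \<and>
     (\<forall>c. \<forall>f\<in>Cinf M. \<xi> (\<lambda>q. c * f q) = c *\<^sub>R \<xi> f) \<and>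
     (\<forall>f\<in>Cinf M. \<forall>g\<in>Cinf M. \<xi> (\<lambda>q. f q * g q) = \<xi> f * \<xi> g) \<and>
     \<xi> (unit_fun M) = 1 \<and>
     (\<forall>f. f \<notin> Cinf M \<longrightarrow> \<xi> f = 0) \<and>
     (\<exists>p\<in>mcarrier M. near_to M p \<xi>)}"

definition tangent_to_weil ::
  "'a manifold \<Rightarrow> 'a \<times> (('a \<Rightarrow> real) \<Rightarrow> real) \<Rightarrow> ('a \<Rightarrow> real) \<Rightarrow> dual" where
  "tangent_to_weil M = (\<lambda>(p, v) f. if f \<in> Cinf M then Dual (f p) (v f) else 0)"

lemma tangent_to_weil_image:
  assumes M: "smooth_manifold M"
  shows "tangent_to_weil M ` tangent_vectors M = weil_bundle M"
proof (intro equalityI subsetI)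
  fix \<xi> assume "\<xi> \<in> tangent_to_weil M ` tangent_vectors M"
  then obtain p v where p: "p \<in> mcarrier M" and v: "v \<in> tangent_space M p"
    and \<xi>: "\<xi> = tangent_to_weil M (p, v)"
    by (auto simp: tangent_vectors_def)
  note C = unit_fun_Cinf[OF M] Cinf_add[OF M] Cinf_mult[OF M] Cinf_cmult[OF M]
  have "v (\<lambda>q. unit_fun M q * unit_fun M q) = v (unit_fun M) * 1 + 1 * v (unit_fun M)"
    using v C(1) p by (simp add: tangent_space_def)
  moreover have "(\<lambda>q. unit_fun M q * unit_fun M q) = unit_fun M"
    by (auto simp: indicator_def)
  ultimately have v1: "v (unit_fun M) = 0" by simp
  have "near_to M p \<xi>"
    unfolding near_to_def dual_dvd_1
    by (simp add: \<xi> tangent_to_weil_def of_real_def minus_dual_def scaleR_dual_def one_dual_def)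
  then show "\<xi> \<in> weil_bundle M"
    using v C p v1
    by (auto simp: weil_bundle_def \<xi> tangent_to_weil_def tangent_space_def plus_dual_def
        scaleR_dual_def times_dual_def one_dual_def zero_dual_def)
next
  fix \<xi> :: "('a \<Rightarrow> real) \<Rightarrow> dual" assume \<xi>: "\<xi> \<in> weil_bundle M"
  then obtain p where p: "p \<in> mcarrier M" and near: "near_to M p \<xi>"
    by (auto simp: weil_bundle_def)
  have re: "re_part (\<xi> f) = f p" if "f \<in> Cinf M" for f
    using near that unfolding near_to_def dual_dvd_1
    by (simp add: of_real_def minus_dual_def scaleR_dual_def one_dual_def)
  define v where "v = (\<lambda>f. eps_part (\<xi> f))"
  have "v \<in> tangent_space M p"
    using \<xi> re unfolding weil_bundle_def tangent_space_def v_def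
    by (auto simp: plus_dual_def scaleR_dual_def times_dual_def zero_dual_def)
  moreover have "\<xi> = tangent_to_weil M (p, v)"
    using \<xi> re by (auto simp: tangent_to_weil_def v_def weil_bundle_def dual.expand fun_eq_iff)
  ultimately show "\<xi> \<in> tangent_to_weil M ` tangent_vectors M"
    using p by (auto simp: tangent_vectors_def)
qed

text \<open>The function \<open>f\<^sup>A\<close>, \<open>f\<^sup>A(\<xi>) = \<xi>(f)\<close>, for the dual numbers, viewed on the tangent bundle.\<close>

definition dual_lift ::
  "'a manifold \<Rightarrow> ('a \<Rightarrow> real) \<Rightarrow> 'a \<times> (('a \<Rightarrow> real) \<Rightarrow> real) \<Rightarrow> dual" where
  "dual_lift M f \<xi> = (if \<xi> \<in> tangent_vectors M then tangent_to_weil M \<xi> f else 0)"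

subsection \<open>Vector fields as derivations into dual-valued functions\<close>

text \<open>Vector fields on the tangent bundle, as derivations from \<open>C\<^sup>\<infinity>(M)\<close> into \<open>C\<^sup>\<infinity>(TM, \<D>)\<close>.\<close>

type_synonym 'a dual_field =
  "('a \<Rightarrow> real) \<Rightarrow> 'a \<times> (('a \<Rightarrow> real) \<Rightarrow> real) \<Rightarrow> dual"

definition dual_fields :: "'a manifold \<Rightarrow> 'a dual_field set" where
  "dual_fields M = {X.
     (\<forall>f\<in>Cinf M. (\<lambda>\<xi>. re_part (X f \<xi>)) \<in> Cinf (tangent_bundle M) \<and>
                 (\<lambda>\<xi>. eps_part (X f \<xi>)) \<in> Cinf (tangent_bundle M)) \<and>
     (\<forall>f\<in>Cinf M. \<forall>g\<in>Cinf M. X (\<lambda>q. f q + g q) = (\<lambda>\<xi>. X f \<xi> + X g \<xi>)) \<and>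
     (\<forall>c. \<forall>f\<in>Cinf M. X (\<lambda>q. c * f q) = (\<lambda>\<xi>. c *\<^sub>R X f \<xi>)) \<and>
     (\<forall>f\<in>Cinf M. \<forall>g\<in>Cinf M. X (\<lambda>q. f q * g q) =
        (\<lambda>\<xi>. X f \<xi> * dual_lift M g \<xi> + dual_lift M f \<xi> * X g \<xi>)) \<and>
     (\<forall>f. f \<notin> Cinf M \<longrightarrow> X f = (\<lambda>\<xi>. 0))}"

text \<open>
  The correspondence \<open>f \<mapsto> \<Sum>i. a\<^sub>i Y(a\<^sub>i\<^sup>* \<circ> f\<^sup>A)\<close> for the basis \<open>1, \<epsilon>\<close> of the dual numbers, first
  for a tangent vector \<open>u\<close> of the tangent bundle, then for a vector field \<open>Y\<close>.
\<close>

definition dual_form_vector ::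
  "'a manifold \<Rightarrow> (('a \<times> (('a \<Rightarrow> real) \<Rightarrow> real) \<Rightarrow> real) \<Rightarrow> real) \<Rightarrow> ('a \<Rightarrow> real) \<Rightarrow> dual" where
  "dual_form_vector M u f =
     (if f \<in> Cinf M
      then Dual (u (\<lambda>\<xi>. re_part (dual_lift M f \<xi>))) (u (\<lambda>\<xi>. eps_part (dual_lift M f \<xi>)))
      else 0)"

definition dual_form ::
  "'a manifold \<Rightarrow>
    (('a \<times> (('a \<Rightarrow> real) \<Rightarrow> real) \<Rightarrow> real) \<Rightarrow> 'a \<times> (('a \<Rightarrow> real) \<Rightarrow> real) \<Rightarrow> real) \<Rightarrow> 'a dual_field" where
  "dual_form M Y f \<xi> = dual_form_vector M (\<lambda>g. Y g \<xi>) f"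

definition induced_field :: "'a manifold \<Rightarrow> (dual \<Rightarrow> dual) \<Rightarrow> 'a dual_field" where
  "induced_field M d f \<xi> = (if f \<in> Cinf M then - d (dual_lift M f \<xi>) else 0)"

definition field_submodule :: "'a manifold \<Rightarrow> 'a dual_field set \<Rightarrow> bool" where
  "field_submodule M S \<longleftrightarrow>
     S \<subseteq> dual_fields M \<and> (\<lambda>f \<xi>. 0) \<in> S \<and>
     (\<forall>X\<in>S. \<forall>Y\<in>S. (\<lambda>f \<xi>. X f \<xi> + Y f \<xi>) \<in> S) \<and>
     (\<forall>h\<in>Cinf (tangent_bundle M). \<forall>X\<in>S. (\<lambda>f \<xi>. h \<xi> *\<^sub>R X f \<xi>) \<in> S)"

definition differential_system :: "'a manifold \<Rightarrow> 'a dual_field set \<Rightarrow> 'a dual_field set" where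
  "differential_system M G = field_submodule M hull G"

definition system_distribution ::
  "'a manifold \<Rightarrow> 'a dual_field set \<Rightarrow> 'a \<times> (('a \<Rightarrow> real) \<Rightarrow> real) \<Rightarrow>
    (('a \<times> (('a \<Rightarrow> real) \<Rightarrow> real) \<Rightarrow> real) \<Rightarrow> real) set" where
  "system_distribution M S \<xi> =
     {u \<in> tangent_space (tangent_bundle M) \<xi>. \<exists>X\<in>S. dual_form_vector M u = (\<lambda>f. X f \<xi>)}"

definition foliation_defined_by ::
  "'a manifold \<Rightarrow> 'a dual_field set \<Rightarrow> ('a \<times> (('a \<Rightarrow> real) \<Rightarrow> real)) set set" where
  "foliation_defined_by M G =
     leaves (tangent_bundle M) (system_distribution M (differential_system M G))"

end

theory Submission
  imports Defs
begin

text \<open>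
  A derivation of the dual numbers kills \<open>1\<close>, and \<open>\<epsilon>\<^sup>2 = 0\<close> forces it to send \<open>\<epsilon>\<close> to a multiple of \<open>\<epsilon>\<close>.
  Hence every induced field is a constant multiple of \<open>(f, v) \<mapsto> \<epsilon> v(f)\<close>, with a nonzero constant for
  some element of a basis. This derivation is the Liouville field: in a chart \<open>f\<^sup>\<D>\<close> is
  \<open>f(x) + \<epsilon> \<Sum>i. y\<^sub>i \<partial>\<^sub>if(x)\<close>, which \<open>\<Sum>i. y\<^sub>i \<partial>/\<partial>y\<^sub>i\<close> maps to \<open>\<epsilon> \<Sum>i. y\<^sub>i \<partial>\<^sub>if(x) = \<epsilon> v(f)\<close>. So the two
  differential systems coincide. Since tangent vectors are derivations of the algebra of global
  smooth functions, the expression of \<open>v(f)\<close> in coordinates rests on Hadamard's lemma and bump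
  functions.
\<close>

section \<open>Calculus on open subsets of Euclidean space\<close>

text \<open>The foliation is built from the differential system alone, so leaves and integral
  manifolds never have to be examined: it suffices that a submodule contains the induced fields
  exactly when it contains the Liouville field. The work lies in evaluating the Liouville field on
  the lifts. Two arbitrary choices stand in the way: \<open>germ_apply\<close> evaluates a tangent
  vector on an unspecified global extension of a coordinate function, and
  \<open>liouville_field\<close> computes in an unspecified chart. Both become harmless once v(f) is
  known, in every chart, to be a combination of the first partial derivatives of f at the base
  point. Moreover \<open>liouville_field\<close> is zero by convention off
  \<open>Cinf (tangent_bundle M)\<close>, so both parts of a lift must first be shown smooth, and
  for v(f) this again takes the coordinate formula. As \<open>Ck_on\<close> rests on iterated
  one-variable derivatives, the chain rule and closure under composition are derived from increments
  along the coordinate directions.\<close>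

lemma Euclidean_space_eq: "Euclidean_space n = subtopology euclidean {x. \<forall>i\<ge>n. x i = 0}"
  by (simp add: Euclidean_space_def euclidean_product_topology)

lemma openin_Euclidean_space_subset:
  "openin (Euclidean_space n) V \<Longrightarrow> x \<in> V \<Longrightarrow> i \<ge> n \<Longrightarrow> x i = 0"
  using openin_subset[of "Euclidean_space n" V] by (auto simp: topspace_Euclidean_space)

lemma continuous_map_Euclidean_iff:
  assumes "V \<subseteq> topspace (Euclidean_space n)"
  shows "continuous_map (subtopology (Euclidean_space n) V) euclideanreal f \<longleftrightarrow> continuous_on V f"
proof -
  have "{x. \<forall>i\<ge>n. x i = 0} \<inter> V = V"
    using assms by (auto simp: topspace_Euclidean_space)
  then show ?thesis
    by (simp add: Euclidean_space_eq subtopology_subtopology)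
qed

section \<open>Boxes, and the local character of differentiability\<close>

definition open_box :: "nat \<Rightarrow> (nat \<Rightarrow> real) \<Rightarrow> real \<Rightarrow> (nat \<Rightarrow> real) set" where
  "open_box n x r = {y. (\<forall>i\<ge>n. y i = 0) \<and> (\<forall>i<n. \<bar>y i - x i\<bar> < r)}"

definition closed_box :: "nat \<Rightarrow> (nat \<Rightarrow> real) \<Rightarrow> real \<Rightarrow> (nat \<Rightarrow> real) set" where
  "closed_box n x r = {y. (\<forall>i\<ge>n. y i = 0) \<and> (\<forall>i<n. \<bar>y i - x i\<bar> \<le> r)}"

lemma openin_open_box: "openin (Euclidean_space n) (open_box n x r)"
proof -
  have "open (\<Inter>i<n. {y::nat \<Rightarrow> real. \<bar>y i - x i\<bar> < r})"
    by (intro open_INT ballI open_Collect_less continuous_intros continuous_on_product_coordinates) auto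
  moreover have "open_box n x r = (\<Inter>i<n. {y::nat \<Rightarrow> real. \<bar>y i - x i\<bar> < r}) \<inter> {x. \<forall>i\<ge>n. x i = 0}"
    by (auto simp: open_box_def)
  ultimately show ?thesis
    unfolding Euclidean_space_eq openin_subtopology by auto
qed

text \<open>As a subset of the full sequence space the box is a product of compact intervals, with
  \<open>{0}\<close> as factor from index \<open>n\<close> on, so Tychonoff applies.\<close>

lemma compact_closed_box: "compactin (Euclidean_space n) (closed_box n x r)"
proof -
  have "closed_box n x r = (\<Pi>\<^sub>E i\<in>UNIV. if i < n then {x i - r..x i + r} else {0})"
  proof (intro set_eqI iffI)
    fix y assume "y \<in> closed_box n x r"
    then show "y \<in> (\<Pi>\<^sub>E i\<in>UNIV. if i < n then {x i - r..x i + r} else {0})"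
      by (force simp: closed_box_def PiE_UNIV_domain abs_le_iff)
  next
    fix y assume "y \<in> (\<Pi>\<^sub>E i\<in>UNIV. if i < n then {x i - r..x i + r} else {0})"
    then have y: "y i \<in> (if i < n then {x i - r..x i + r} else {0})" for i
      by (simp add: PiE_UNIV_domain Pi_iff)
    have "\<bar>y i - x i\<bar> \<le> r" if "i < n" for i
      using y[of i] that by (auto simp: abs_le_iff)
    moreover have "y i = 0" if "i \<ge> n" for i
      using y[of i] that by auto
    ultimately show "y \<in> closed_box n x r"
      by (simp add: closed_box_def)
  qed
  moreover have "compactin (powertop_real UNIV) (\<Pi>\<^sub>E i\<in>UNIV. if i < n then {x i - r..x i + r} else {0})"
    unfolding compactin_PiE by auto
  ultimately show ?thesis
    by (auto simp: Euclidean_space_def compactin_subtopology closed_box_def)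
qed

lemma open_box_subset:
  assumes V: "openin (Euclidean_space n) V" and x: "x \<in> V"
  obtains r where "r > 0" "open_box n x r \<subseteq> V"
proof -
  obtain T where T: "openin (powertop_real UNIV) T" "V = T \<inter> {x. \<forall>i\<ge>n. x i = 0}"
    using V unfolding Euclidean_space_def openin_subtopology by auto
  obtain X where X: "x \<in> (\<Pi>\<^sub>E i\<in>UNIV. X i)" "\<And>i. open (X i)" "(\<Pi>\<^sub>E i\<in>UNIV. X i) \<subseteq> T"
    using product_topology_open_contains_basis[OF T(1), of x] x T(2) by auto
  have "\<forall>i. \<exists>e>0. \<forall>t. \<bar>t - x i\<bar> < e \<longrightarrow> t \<in> X i"
    using X by (force simp: open_dist dist_real_def)
  then obtain e where e: "\<And>i. e i > 0" "\<And>i t. \<bar>t - x i\<bar> < e i \<Longrightarrow> t \<in> X i"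
    by metis
  \<comment> \<open>The 1 keeps the set nonempty when \<open>n\<close> is 0. From index
    \<open>n\<close> on, points of the box agree with \<open>x\<close>, so only finitely many of the
    radii \<open>e i\<close> enter the minimum.\<close>
  define r where "r = Min (insert 1 (e ` {..<n}))"
  have r: "r > 0" "\<And>i. i < n \<Longrightarrow> r \<le> e i"
    using e(1) by (auto simp: r_def)
  have "y \<in> V" if "y \<in> open_box n x r" for y
  proof -
    have "y i \<in> X i" for i
    proof (cases "i < n")
      case True
      then show ?thesis
        using that r(2)[of i] by (intro e(2)) (auto simp: open_box_def)
    next
      case False
      then show ?thesis
        using that x T(2) e(1)[of i] by (intro e(2)) (auto simp: open_box_def)
    qed
    then show ?thesis
      using X(3) that T(2) by (auto simp: open_box_def)
  qed
  then show ?thesis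
    using that r(1) by blast
qed

lemma Ck_on_subset: "Ck_on k n V f \<Longrightarrow> V' \<subseteq> V \<Longrightarrow> Ck_on k n V' f"
proof (induction k arbitrary: f)
  case 0
  then show ?case
    by (auto intro: continuous_map_from_subtopology_mono)
next
  case (Suc k)
  then show ?case
    by (auto intro: continuous_map_from_subtopology_mono)
qed

lemma Ck_on_continuous:
  assumes "openin (Euclidean_space n) V" "Ck_on k n V f"
  shows "continuous_on V f"
  using assms continuous_map_Euclidean_iff[OF openin_subset[OF assms(1)]] by (cases k) auto

text \<open>This serves to glue: a function extended by zero is given by different formulas on two
  open pieces of a chart.\<close>

lemma Ck_on_open_cover:
  assumes "openin (Euclidean_space n) V"
    and "\<And>x. x \<in> V \<Longrightarrow> \<exists>W. openin (Euclidean_space n) W \<and> x \<in> W \<and> Ck_on k n W f"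
  shows "Ck_on k n V f"
  using assms(2)
proof (induction k arbitrary: f)
  case 0
  have "continuous_on V f"
    unfolding continuous_on_eq_continuous_within
  proof
    fix x assume x: "x \<in> V"
    then obtain W where W: "openin (Euclidean_space n) W" "x \<in> W" "Ck_on 0 n W f"
      using 0 by blast
    obtain T where T: "open T" "W = T \<inter> {x. \<forall>i\<ge>n. x i = 0}"
      using W(1) unfolding Euclidean_space_eq openin_subtopology by auto
    have "continuous (at x within W) f"
      using Ck_on_continuous[OF W(1,3)] W(2) by (simp add: continuous_on_eq_continuous_within)
    moreover have "W \<inter> V = T \<inter> V"
      using openin_Euclidean_space_subset[OF assms(1)] T by auto
    ultimately have "continuous (at x within T \<inter> V) f"
      by (metis continuous_within_subset inf_le1)
    moreover have "at x within T \<inter> V = at x within V"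
      using at_within_open_subset T W(2) by (metis (no_types, lifting) IntD1 Int_commute at_within_nhd inf.right_idem)
    ultimately show "continuous (at x within V) f"
      by simp
  qed
  then show ?case
    using continuous_map_Euclidean_iff[OF openin_subset[OF assms(1)]] by simp
next
  case (Suc k)
  have "Ck_on k n V f"
    by (rule Suc.IH) (meson Suc.prems Ck_on_Suc_D)
  then have "continuous_map (subtopology (Euclidean_space n) V) euclideanreal f"
    using Ck_on_continuous[OF assms(1)] continuous_map_Euclidean_iff[OF openin_subset[OF assms(1)]]
    by blast
  moreover have "Ck_on k n V (partial_deriv i f)" if "i < n" for i
    by (rule Suc.IH) (meson Suc.prems that Ck_on.simps(2))
  moreover have "(\<lambda>t. f (x(i := t))) field_differentiable at (x i)" if "x \<in> V" "i < n" for x i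
    using Suc.prems[OF that(1)] that(2) by auto
  ultimately show ?case
    by simp
qed

lemma Ck_on_sum:
  assumes "openin (Euclidean_space n) V" "\<And>i. i \<in> I \<Longrightarrow> Ck_on k n V (f i)"
  shows "Ck_on k n V (\<lambda>x. \<Sum>i\<in>I. f i x)"
  using assms(2)
  by (induction I rule: infinite_finite_induct)
    (auto intro!: Ck_on_const Ck_on_add[OF assms(1)])

lemma Ck_on_cmult:
  assumes "openin (Euclidean_space n) V" "Ck_on k n V f"
  shows "Ck_on k n V (\<lambda>x. c * f x)"
  by (rule Ck_on_mult[OF assms(1) Ck_on_const assms(2)])

lemma Ck_on_diff:
  assumes "openin (Euclidean_space n) V" "Ck_on k n V f" "Ck_on k n V g"
  shows "Ck_on k n V (\<lambda>x. f x - g x)"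
  using Ck_on_add[OF assms(1,2) Ck_on_cmult[OF assms(1,3), of "-1"]] by simp

lemma Ck_on_partial_deriv:
  "Ck_on (Suc k) n V f \<Longrightarrow> i < n \<Longrightarrow> Ck_on k n V (partial_deriv i f)"
  by simp

lemma Ck_on_DERIV:
  assumes "Ck_on (Suc k) n V f" "i < n" "x \<in> V"
  shows "((\<lambda>t. f (x(i := t))) has_field_derivative partial_deriv i f x) (at (x i))"
  using assms by (simp add: partial_deriv_def DERIV_deriv_iff_field_differentiable)

lemma partial_derivI:
  "((\<lambda>t. f (x(i := t))) has_field_derivative D) (at (x i)) \<Longrightarrow> partial_deriv i f x = D"
  by (simp add: partial_deriv_def DERIV_imp_deriv)

text \<open>A formula \<open>g i\<close> for the derivative is known on \<open>V\<close> only,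
  whereas \<open>partial_deriv i f\<close> is a total function. Since \<open>V\<close> is open,
  agreement on \<open>V\<close> transfers the class. The later inductions on the order of
  differentiability take their successor step through this rule.\<close>

lemma Ck_on_SucI:
  assumes V: "openin (Euclidean_space n) V" and "continuous_on V f"
    and D: "\<And>i x. i < n \<Longrightarrow> x \<in> V \<Longrightarrow> ((\<lambda>t. f (x(i := t))) has_field_derivative g i x) (at (x i))"
    and g: "\<And>i. i < n \<Longrightarrow> Ck_on k n V (g i)"
  shows "Ck_on (Suc k) n V f"
proof -
  have "Ck_on k n V (partial_deriv i f)" if "i < n" for i
    by (rule Ck_on_cong[OF V _ g[OF that]]) (metis D[OF that] partial_derivI)
  then show ?thesis
    using assms continuous_map_Euclidean_iff[OF openin_subset[OF V]]
    by (auto simp: field_differentiable_def)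
qed

lemma continuous_on_coordinate: "continuous_on V (\<lambda>x::nat \<Rightarrow> real. x j)"
  by (rule continuous_on_subset[OF continuous_on_product_coordinates]) simp

lemma Ck_on_coordinate:
  assumes V: "openin (Euclidean_space n) V"
  shows "Ck_on k n V (\<lambda>x. x j)"
proof (cases k)
  case 0
  then show ?thesis
    using continuous_map_Euclidean_iff[OF openin_subset[OF V]] continuous_on_coordinate by simp
next
  case (Suc k')
  have "((\<lambda>t. (x(i := t)) j) has_field_derivative (if i = j then 1 else 0)) (at (x i))"
    for i and x :: "nat \<Rightarrow> real"
    by simp
  then show ?thesis
    unfolding Suc by (rule Ck_on_SucI[OF V continuous_on_coordinate _ Ck_on_const])
qed

section \<open>Increments of C^1 functions, the chain rule and composition\<close>

lemma openin_Collect_dist_less: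
  assumes V: "openin (Euclidean_space n) V" and g: "continuous_on V (g :: _ \<Rightarrow> real)"
  shows "openin (Euclidean_space n) {z \<in> V. \<bar>g z - c\<bar> < e}"
proof -
  have "continuous_map (subtopology (Euclidean_space n) V) euclideanreal g"
    using g continuous_map_Euclidean_iff[OF openin_subset[OF V]] by simp
  then have "openin (subtopology (Euclidean_space n) V)
      {z \<in> topspace (subtopology (Euclidean_space n) V). g z \<in> ball c e}"
    by (rule openin_continuous_map_preimage) simp
  moreover have "{z \<in> topspace (subtopology (Euclidean_space n) V). g z \<in> ball c e} = {z \<in> V. \<bar>g z - c\<bar> < e}"
    using openin_subset[OF V] by (auto simp: dist_real_def abs_minus_commute)
  ultimately show ?thesis
    using V openin_trans_full by metis
qed

text \<open>In terms of difference quotients the mean value theorem is symmetric in the endpoints.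
  This matters because a coordinate of \<open>y\<close> may lie on either side of that of
  \<open>x\<close>.\<close>

lemma real_MVT_between:
  fixes g g' :: "real \<Rightarrow> real"
  assumes "a \<noteq> b" "\<And>t. min a b \<le> t \<Longrightarrow> t \<le> max a b \<Longrightarrow> (g has_field_derivative g' t) (at t)"
  obtains z where "min a b \<le> z" "z \<le> max a b" "(g b - g a) / (b - a) = g' z"
proof (cases "a < b")
  case True
  then obtain z where "a < z" "z < b" "g b - g a = (b - a) * g' z"
    using MVT2[of a b g g'] assms(2) by auto
  then show ?thesis
    using that[of z] True by simp
next
  case False
  then have "b < a" using assms(1) by simp
  then obtain z where "b < z" "z < a" "g a - g b = (a - b) * g' z"
    using MVT2[of b a g g'] assms(2) by auto
  then show ?thesis
    using that[of z] \<open>b < a\<close> by (simp add: field_simps)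
qed

text \<open>
  Along the hybrid points, which agree with \<open>y\<close> before index \<open>j\<close> and with \<open>x\<close> from there on, one
  coordinate changes at a time, so the one-variable mean value theorem applies.
\<close>

lemma difference_quotients:
  assumes V: "openin (Euclidean_space n) V" and f: "Ck_on (Suc 0) n V f" and x: "x \<in> V"
  shows "\<exists>D. (\<forall>y. (\<forall>i\<ge>n. y i = 0) \<longrightarrow> f y - f x = (\<Sum>j<n. (y j - x j) * D j y)) \<and>
    (\<forall>j<n. \<forall>e>0. \<exists>\<delta>>0. \<forall>y\<in>open_box n x \<delta>. \<bar>D j y - partial_deriv j f x\<bar> < e)"
proof -
  define H where "H = (\<lambda>j (y::nat \<Rightarrow> real) i. if i < j then y i else x i)"
  \<comment> \<open>If \<open>y j = x j\<close> the increment in direction \<open>j\<close> is zero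
    and any value would satisfy the sum formula; the partial derivative is the value that also makes
    \<open>D j\<close> converge to it at \<open>x\<close>.\<close>
  define D where "D = (\<lambda>j y. if y j = x j then partial_deriv j f x
    else (f (H (Suc j) y) - f (H j y)) / (y j - x j))"
  have x0: "x i = 0" if "i \<ge> n" for i
    using openin_Euclidean_space_subset[OF V x that] .
  have H_upd: "(H j y)(j := y j) = H (Suc j) y" "(H j y)(j := x j) = H j y" for j y
    by (auto simp: H_def fun_eq_iff less_Suc_eq)
  have "f y - f x = (\<Sum>j<n. (y j - x j) * D j y)" if y: "\<forall>i\<ge>n. y i = 0" for y
  proof -
    have "H n y = y" "H 0 y = x"
      using x0 y by (auto simp: H_def fun_eq_iff)
    then have "f y - f x = (\<Sum>j<n. f (H (Suc j) y) - f (H j y))"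
      using sum_lessThan_telescope[of "\<lambda>j. f (H j y)" n] by simp
    also have "\<dots> = (\<Sum>j<n. (y j - x j) * D j y)"
    proof (rule sum.cong)
      show "f (H (Suc j) y) - f (H j y) = (y j - x j) * D j y" for j
      proof (cases "y j = x j")
        case True
        then have "H (Suc j) y = H j y"
          using H_upd[of j y] by metis
        then show ?thesis
          using True by simp
      qed (simp add: D_def)
    qed simp
    finally show ?thesis .
  qed
  moreover have "\<exists>\<delta>>0. \<forall>y\<in>open_box n x \<delta>. \<bar>D j y - partial_deriv j f x\<bar> < e" if j: "j < n" and e: "e > 0" for j e
  proof -
    \<comment> \<open>A box inside \<open>W\<close> contains the whole segment from
      \<open>H j y\<close> to \<open>H (Suc j) y\<close>, hence also the intermediate point of the
      mean value theorem, wherever it lies.\<close>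
    define W where "W = {z \<in> V. \<bar>partial_deriv j f z - partial_deriv j f x\<bar> < e}"
    have "openin (Euclidean_space n) W" "x \<in> W"
      unfolding W_def
      using e x openin_Collect_dist_less[OF V Ck_on_continuous[OF V Ck_on_partial_deriv[OF f j]]]
      by auto
    then obtain \<delta> where \<delta>: "\<delta> > 0" "open_box n x \<delta> \<subseteq> W"
      by (rule open_box_subset)
    have "\<bar>D j y - partial_deriv j f x\<bar> < e" if y: "y \<in> open_box n x \<delta>" for y
    proof (cases "y j = x j")
      case False
      have box: "(H j y)(j := t) \<in> open_box n x \<delta>" if "min (x j) (y j) \<le> t" "t \<le> max (x j) (y j)" for t
      proof -
        have "\<bar>y j - x j\<bar> < \<delta>" "\<bar>y i - x i\<bar> < \<delta>" if "i < n" for i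
          using y j that by (auto simp: open_box_def)
        moreover have "\<bar>t - x j\<bar> \<le> \<bar>y j - x j\<bar>"
          using that by (auto simp: min_def max_def split: if_splits)
        ultimately have "\<bar>((H j y)(j := t)) i - x i\<bar> < \<delta>" if "i < n" for i
          using j \<delta>(1) that by (cases "i = j") (force simp: H_def)+
        then show ?thesis
          using x0 y j by (auto simp: open_box_def H_def)
      qed
      obtain z where z: "min (x j) (y j) \<le> z" "z \<le> max (x j) (y j)"
        "(f ((H j y)(j := y j)) - f ((H j y)(j := x j))) / (y j - x j) = partial_deriv j f ((H j y)(j := z))"
      proof (rule real_MVT_between)
        fix t assume "min (x j) (y j) \<le> t" "t \<le> max (x j) (y j)"
        then have "(H j y)(j := t) \<in> V"
          using box \<delta>(2) by (auto simp: W_def)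
        from Ck_on_DERIV[OF f j this]
        show "((\<lambda>t. f ((H j y)(j := t))) has_field_derivative partial_deriv j f ((H j y)(j := t))) (at t)"
          by simp
      qed (use False in auto)
      then show ?thesis
        using box[OF z(1,2)] \<delta>(2) False unfolding H_upd by (auto simp: D_def W_def)
    qed (simp add: D_def e)
    then show ?thesis
      using \<delta>(1) by blast
  qed
  ultimately show ?thesis
    by (intro exI[of _ D]) simp
qed

text \<open>Divide the increment formula of \<open>difference_quotients\<close> at
  \<open>\<gamma> t\<close> by \<open>t - t0\<close>: each summand is
  \<open>D j (\<gamma> t)\<close> times a difference quotient of a coordinate of
  \<open>\<gamma>\<close>, and both factors have limits.\<close>

lemma Ck_on_chain_rule:
  assumes V: "openin (Euclidean_space n) V" and f: "Ck_on (Suc 0) n V f" and x: "\<gamma> t0 \<in> V"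
    and \<gamma>: "\<forall>\<^sub>F t in at t0. \<forall>i\<ge>n. \<gamma> t i = 0"
    and \<gamma>': "\<And>j. j < n \<Longrightarrow> ((\<lambda>t. \<gamma> t j) has_field_derivative \<gamma>' j) (at t0)"
  shows "((\<lambda>t. f (\<gamma> t)) has_field_derivative (\<Sum>j<n. partial_deriv j f (\<gamma> t0) * \<gamma>' j)) (at t0)"
proof -
  obtain D where D: "\<forall>y. (\<forall>i\<ge>n. y i = 0) \<longrightarrow> f y - f (\<gamma> t0) = (\<Sum>j<n. (y j - \<gamma> t0 j) * D j y)"
    and lim: "\<forall>j<n. \<forall>e>0. \<exists>\<delta>>0. \<forall>y\<in>open_box n (\<gamma> t0) \<delta>.
      \<bar>D j y - partial_deriv j f (\<gamma> t0)\<bar> < e"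
    using difference_quotients[OF V f x] by blast
  have box: "\<forall>\<^sub>F t in at t0. \<gamma> t \<in> open_box n (\<gamma> t0) \<delta>" if "\<delta> > 0" for \<delta>
  proof -
    have "\<forall>\<^sub>F t in at t0. \<bar>\<gamma> t j - \<gamma> t0 j\<bar> < \<delta>" if "j < n" for j
      using DERIV_isCont[OF \<gamma>'[OF that]] \<open>\<delta> > 0\<close> unfolding isCont_def tendsto_iff dist_real_def by blast
    then have "\<forall>\<^sub>F t in at t0. \<forall>j\<in>{..<n}. \<bar>\<gamma> t j - \<gamma> t0 j\<bar> < \<delta>"
      by (intro eventually_ball_finite) auto
    with \<gamma> show ?thesis
      by eventually_elim (auto simp: open_box_def)
  qed
  have "((\<lambda>t. D j (\<gamma> t)) \<longlongrightarrow> partial_deriv j f (\<gamma> t0)) (at t0)" if j: "j < n" for j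
    unfolding tendsto_iff dist_real_def
  proof (intro allI impI)
    fix e :: real assume "e > 0"
    then obtain \<delta> where "\<delta> > 0" and \<delta>: "\<forall>y\<in>open_box n (\<gamma> t0) \<delta>. \<bar>D j y - partial_deriv j f (\<gamma> t0)\<bar> < e"
      using lim[rule_format, OF j \<open>e > 0\<close>] by (elim exE conjE)
    show "\<forall>\<^sub>F t in at t0. \<bar>D j (\<gamma> t) - partial_deriv j f (\<gamma> t0)\<bar> < e"
      by (rule eventually_mono[OF box[OF \<open>\<delta> > 0\<close>]]) (simp add: \<delta>)
  qed
  moreover have "((\<lambda>t. (\<gamma> t j - \<gamma> t0 j) / (t - t0)) \<longlongrightarrow> \<gamma>' j) (at t0)" if "j < n" for j
    using \<gamma>'[OF that] by (simp add: has_field_derivative_iff)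
  ultimately have "((\<lambda>t. \<Sum>j<n. D j (\<gamma> t) * ((\<gamma> t j - \<gamma> t0 j) / (t - t0))) \<longlongrightarrow>
      (\<Sum>j<n. partial_deriv j f (\<gamma> t0) * \<gamma>' j)) (at t0)"
    by (intro tendsto_sum tendsto_mult) auto
  moreover have "\<forall>\<^sub>F t in at t0. (\<Sum>j<n. D j (\<gamma> t) * ((\<gamma> t j - \<gamma> t0 j) / (t - t0))) =
      (f (\<gamma> t) - f (\<gamma> t0)) / (t - t0)"
    by (rule eventually_mono[OF \<gamma>]) (simp add: D sum_divide_distrib mult.commute)
  ultimately show ?thesis
    unfolding has_field_derivative_iff by (rule Lim_transform_eventually)
qed

lemma Ck_on_le: "j \<le> k \<Longrightarrow> Ck_on k n V f \<Longrightarrow> Ck_on j n V f"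
  by (induction rule: inc_induct) (simp_all only: Ck_on_Suc_D)

text \<open>The chain rule expresses a partial derivative of the composite through partial
  derivatives of \<open>h\<close>, again composed with \<open>\<tau>\<close>. The induction
  therefore ranges over all \<open>h\<close>, with \<open>\<tau>\<close> fixed.\<close>

lemma Ck_on_compose:
  assumes W: "openin (Euclidean_space m) W" and V: "openin (Euclidean_space n) V"
    and \<tau>: "\<And>x. x \<in> W \<Longrightarrow> \<tau> x \<in> V"
    and "\<And>j. j < n \<Longrightarrow> Ck_on k m W (\<lambda>x. \<tau> x j)" and "Ck_on k n V h"
  shows "Ck_on k m W (\<lambda>x. h (\<tau> x))"
  using assms(4,5)
proof (induction k arbitrary: h)
  case 0
  have "continuous_on W (\<lambda>x. \<tau> x j)" for j
  proof (cases "j < n")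
    case True
    then show ?thesis
      using 0(1) Ck_on_continuous[OF W] by blast
  next
    \<comment> \<open>Continuity into the sequence space concerns every coordinate. From index
      \<open>n\<close> on they vanish because \<open>\<tau>\<close> takes values in
      \<open>V\<close>.\<close>
    case False
    then have "\<tau> x j = 0" if "x \<in> W" for x
      using openin_Euclidean_space_subset[OF V \<tau>[OF that]] by simp
    then show ?thesis
      by (simp cong: continuous_on_cong)
  qed
  then have "continuous_on W \<tau>"
    by (rule continuous_on_coordinatewise_then_product)
  then have "continuous_on W (\<lambda>x. h (\<tau> x))"
    using continuous_on_compose2[OF Ck_on_continuous[OF V 0(2)]] \<tau> by blast
  then show ?case
    using continuous_map_Euclidean_iff[OF openin_subset[OF W]] by simp
next
  case (Suc k)
  have c: "Ck_on k m W (\<lambda>x. h (\<tau> x))"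
    by (rule Suc.IH) (simp_all only: Ck_on_Suc_D[OF Suc.prems(1)] Ck_on_Suc_D[OF Suc.prems(2)])
  have h1: "Ck_on (Suc 0) n V h"
    by (rule Ck_on_le[OF _ Suc.prems(2)]) simp
  show ?case
  proof (rule Ck_on_SucI[OF W Ck_on_continuous[OF W c]])
    fix i assume i: "i < m"
    show "Ck_on k m W (\<lambda>x. \<Sum>j<n. partial_deriv j h (\<tau> x) * partial_deriv i (\<lambda>x. \<tau> x j) x)"
    proof (rule Ck_on_sum[OF W], rule Ck_on_mult[OF W])
      fix j assume "j \<in> {..<n}"
      then have j: "j < n" by simp
      show "Ck_on k m W (\<lambda>x. partial_deriv j h (\<tau> x))"
        by (rule Suc.IH[OF Ck_on_Suc_D[OF Suc.prems(1)] Ck_on_partial_deriv[OF Suc.prems(2) j]])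
      show "Ck_on k m W (partial_deriv i (\<lambda>x. \<tau> x j))"
        by (rule Ck_on_partial_deriv[OF Suc.prems(1)[OF j] i])
    qed
    fix x assume x: "x \<in> W"
    show "((\<lambda>t. h (\<tau> (x(i := t)))) has_field_derivative
       (\<Sum>j<n. partial_deriv j h (\<tau> x) * partial_deriv i (\<lambda>x. \<tau> x j) x)) (at (x i))"
    proof -
      have "\<forall>\<^sub>F t in at (x i). x(i := t) \<in> W"
        using Euclidean_space_upd[OF W x i] eventually_nhds_conv_at by blast
      then have "\<forall>\<^sub>F t in at (x i). \<forall>j\<ge>n. \<tau> (x(i := t)) j = 0"
        by (rule eventually_mono) (simp add: openin_Euclidean_space_subset[OF V \<tau>])
      moreover have "((\<lambda>t. \<tau> (x(i := t)) j) has_field_derivative partial_deriv i (\<lambda>x. \<tau> x j) x) (at (x i))"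
        if "j < n" for j
        using Ck_on_DERIV[OF Suc.prems(1)[OF that] i x] .
      ultimately show ?thesis
        using Ck_on_chain_rule[OF V h1, of "\<lambda>t. \<tau> (x(i := t))" "x i"] \<tau>[OF x] by simp
    qed
  qed
qed

section \<open>Segments from a base point and Hadamard's lemma\<close>

definition ray :: "(nat \<Rightarrow> real) \<Rightarrow> (nat \<Rightarrow> real) \<Rightarrow> real \<Rightarrow> nat \<Rightarrow> real" where
  "ray a x t = (\<lambda>j. a j + t * (x j - a j))"

lemma continuous_on_ray: "continuous_on S (\<lambda>(x, t). ray a x t)"
proof (rule continuous_on_coordinatewise_then_product)
  fix i
  have "continuous_on S (\<lambda>p. (fst p) i)"
    by (rule continuous_on_compose2[OF continuous_on_product_coordinates continuous_on_fst[OF continuous_on_id]]) auto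
  then show "continuous_on S (\<lambda>p. (case p of (x, t) \<Rightarrow> ray a x t) i)"
    by (auto simp: ray_def case_prod_beta intro!: continuous_intros)
qed

text \<open>Joint continuity over \<open>V\<close> times a compact interval is what both continuity
  of parameter integrals and the Leibniz rule ask for.\<close>

lemma continuous_on_weighted_ray:
  assumes "openin (Euclidean_space n) V" "Ck_on k n V f"
    and "\<And>x t. x \<in> V \<Longrightarrow> t \<in> {0..1} \<Longrightarrow> ray a x t \<in> V"
  shows "continuous_on (V \<times> cbox 0 1) (\<lambda>(x, t). t ^ m * f (ray a x t))"
proof -
  have "continuous_on (V \<times> cbox 0 1) (\<lambda>p. f ((\<lambda>(x, t). ray a x t) p))"
    by (rule continuous_on_compose2[OF Ck_on_continuous[OF assms(1,2)] continuous_on_ray])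
      (use assms(3) in auto)
  then show ?thesis
    by (auto simp: case_prod_beta intro!: continuous_intros)
qed

lemma integrable_weighted_ray:
  assumes "openin (Euclidean_space n) V" "Ck_on k n V f"
    and "\<And>x t. x \<in> V \<Longrightarrow> t \<in> {0..1} \<Longrightarrow> ray a x t \<in> V" and "x \<in> V"
  shows "(\<lambda>t. t ^ m * f (ray a x t)) integrable_on cbox 0 1"
proof (rule integrable_continuous)
  have "continuous_on (cbox 0 1) (\<lambda>t. (\<lambda>(x, t). t ^ m * f (ray a x t)) (x, t))"
    by (rule continuous_on_compose2[OF continuous_on_weighted_ray[OF assms(1-3)]
          continuous_on_Pair[OF continuous_on_const continuous_on_id]]) (use assms(4) in auto)
  then show "continuous_on (cbox 0 1) (\<lambda>t. t ^ m * f (ray a x t))"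
    by simp
qed

text \<open>
  Differentiating under the integral sign turns the weight \<open>t\<^sup>m\<close> into \<open>t\<^sup>m\<^sup>+\<^sup>1\<close>; allowing all weights
  makes the induction on \<open>k\<close> go through.
\<close>

lemma Ck_on_ray_integral:
  assumes V: "openin (Euclidean_space n) V"
    and star: "\<And>x t. x \<in> V \<Longrightarrow> t \<in> {0..1} \<Longrightarrow> ray a x t \<in> V"
    and "Ck_on k n V f"
  shows "Ck_on k n V (\<lambda>x. integral (cbox 0 1) (\<lambda>t. t ^ m * f (ray a x t)))"
  using assms(3)
proof (induction k arbitrary: f m)
  case 0
  show ?case
    using integral_continuous_on_param[OF continuous_on_weighted_ray[OF V 0 star, of m]]
      continuous_map_Euclidean_iff[OF openin_subset[OF V]] by simp
next
  case (Suc k)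
  have cont: "continuous_on V (\<lambda>x. integral (cbox 0 1) (\<lambda>t. t ^ m * f (ray a x t)))"
    using integral_continuous_on_param[OF continuous_on_weighted_ray[OF V Suc.prems star, of m]] .
  show ?case
  proof (rule Ck_on_SucI[OF V cont])
    fix i assume i: "i < n"
    show "Ck_on k n V (\<lambda>x. integral (cbox 0 1) (\<lambda>t. t ^ Suc m * partial_deriv i f (ray a x t)))"
      by (rule Suc.IH[OF Ck_on_partial_deriv[OF Suc.prems i]])
    fix x assume x: "x \<in> V"
    \<comment> \<open>The Leibniz rule wants a convex parameter set; this ball around
      \<open>x i\<close> also keeps the modified points in \<open>V\<close>.\<close>
    obtain d where "d > 0" and d: "\<And>s. dist s (x i) < d \<Longrightarrow> x(i := s) \<in> V"
      using Euclidean_space_upd[OF V x i] unfolding eventually_nhds_metric by blast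
    have "((\<lambda>s. integral (cbox 0 1) (\<lambda>t. t ^ m * f (ray a (x(i := s)) t))) has_field_derivative
        integral (cbox 0 1) (\<lambda>t. t ^ Suc m * partial_deriv i f (ray a (x(i := x i)) t))) (at (x i) within ball (x i) d)"
    proof (rule leibniz_rule_field_derivative)
      fix s :: real and t :: real assume s: "s \<in> ball (x i) d" and t: "t \<in> cbox 0 1"
      define z where "z = ray a (x(i := s)) t"
      have z: "z \<in> V"
        unfolding z_def using s t d star by (auto simp: dist_commute)
      \<comment> \<open>Coordinate \<open>i\<close> of the point on the segment is affine in
        \<open>s\<close> with slope \<open>t\<close>; this slope is the additional factor in the
        weight.\<close>
      have zi: "z i = a i + t * (s - a i)"
        by (simp add: z_def ray_def)
      have "((\<lambda>s. f (z(i := a i + t * (s - a i)))) has_field_derivative partial_deriv i f z * t) (at s)"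
        by (rule DERIV_chain2[where f="\<lambda>u. f (z(i := u))" and g="\<lambda>s. a i + t * (s - a i)", OF Ck_on_DERIV[OF Suc.prems i z, unfolded zi]]) (auto intro!: derivative_eq_intros)
      moreover have "z(i := a i + t * (s' - a i)) = ray a (x(i := s')) t" for s'
        by (auto simp: z_def ray_def)
      ultimately have "((\<lambda>s. f (ray a (x(i := s)) t)) has_field_derivative partial_deriv i f z * t) (at s)"
        by simp
      from DERIV_cmult[OF this, of "t ^ m"]
      show "((\<lambda>s. t ^ m * f (ray a (x(i := s)) t)) has_field_derivative
          t ^ Suc m * partial_deriv i f (ray a (x(i := s)) t)) (at s within ball (x i) d)"
        by - (rule has_field_derivative_at_within, simp add: z_def mult_ac)
    next
      fix s assume "s \<in> ball (x i) d"
      then have xs: "x(i := s) \<in> V"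
        using d by (simp add: dist_commute)
      show "(\<lambda>t. t ^ m * f (ray a (x(i := s)) t)) integrable_on cbox 0 1"
        by (rule integrable_weighted_ray[OF V Suc.prems star xs])
    next
      have c: "continuous_on (ball (x i) d \<times> cbox (0::real) 1) (\<lambda>p. x(i := fst p))"
      proof (rule continuous_on_coordinatewise_then_product)
        show "continuous_on (ball (x i) d \<times> cbox (0::real) 1) (\<lambda>p. (x(i := fst p)) j)" for j
          by (cases "j = i") (auto intro!: continuous_intros)
      qed
      have "continuous_on (ball (x i) d \<times> cbox 0 1)
          (\<lambda>p. case (x(i := fst p), snd p) of (x, t) \<Rightarrow> t ^ Suc m * partial_deriv i f (ray a x t))"
        by (rule continuous_on_compose2[OF continuous_on_weighted_ray[OF V Ck_on_partial_deriv[OF Suc.prems i] star]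
              continuous_on_Pair[OF c continuous_on_snd[OF continuous_on_id]]])
          (use d in \<open>auto simp: dist_commute\<close>)
      then show "continuous_on (ball (x i) d \<times> cbox 0 1)
          (\<lambda>(s, t). t ^ Suc m * partial_deriv i f (ray a (x(i := s)) t))"
        by (simp add: case_prod_beta)
    qed (use \<open>d > 0\<close> in auto)
    then show "((\<lambda>s. integral (cbox 0 1) (\<lambda>t. t ^ m * f (ray a (x(i := s)) t))) has_field_derivative
        integral (cbox 0 1) (\<lambda>t. t ^ Suc m * partial_deriv i f (ray a x t))) (at (x i))"
      using at_within_open[of "x i" "ball (x i) d"] \<open>d > 0\<close> by simp
  qed
qed

text \<open>Integrate the derivative of \<open>f\<close> along the segment from \<open>a\<close> to
  \<open>x\<close>: the factors \<open>x i - a i\<close> do not depend on \<open>t\<close> and come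
  out of the integral. For \<open>x = a\<close> the integrand is constant on an interval of length
  1, which gives the value of \<open>g i\<close> there.\<close>

lemma hadamard:
  assumes V: "openin (Euclidean_space n) V" and a: "a \<in> V"
    and star: "\<And>x t. x \<in> V \<Longrightarrow> t \<in> {0..1} \<Longrightarrow> ray a x t \<in> V"
    and f: "smooth_on n V f"
  shows "\<exists>g. (\<forall>i<n. smooth_on n V (g i) \<and> g i a = partial_deriv i f a) \<and>
    (\<forall>x\<in>V. f x = f a + (\<Sum>i<n. (x i - a i) * g i x))"
proof -
  define g where "g = (\<lambda>i x. integral (cbox 0 1) (\<lambda>t. partial_deriv i f (ray a x t)))"
  have f': "Ck_on k n V (partial_deriv i f)" if "i < n" for i k
    by (rule Ck_on_partial_deriv[OF _ that]) (use f in \<open>simp only: smooth_on_def\<close>)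
  have smooth: "smooth_on n V (g i)" if "i < n" for i
    unfolding smooth_on_def
  proof
    show "Ck_on k n V (g i)" for k
      using Ck_on_ray_integral[OF V star f'[OF that], of k 0] by (simp add: g_def)
  qed
  have "ray a a t = a" for t
    by (simp add: ray_def)
  then have g_a: "g i a = partial_deriv i f a" for i
    by (simp add: g_def)
  have "f x = f a + (\<Sum>i<n. (x i - a i) * g i x)" if x: "x \<in> V" for x
  proof -
    have "((\<lambda>t. f (ray a x t)) has_field_derivative (\<Sum>i<n. partial_deriv i f (ray a x t) * (x i - a i))) (at t)"
      if t: "t \<in> {0..1}" for t
    proof (rule Ck_on_chain_rule[OF V])
      show "Ck_on (Suc 0) n V f"
        using f unfolding smooth_on_def by (rule spec)
      show "ray a x t \<in> V"
        using star x t by blast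
      show "\<forall>\<^sub>F t in at t. \<forall>i\<ge>n. ray a x t i = 0"
        using openin_Euclidean_space_subset[OF V x] openin_Euclidean_space_subset[OF V a]
        by (simp add: ray_def)
      show "((\<lambda>t. ray a x t i) has_field_derivative x i - a i) (at t)" for i
        unfolding ray_def by (auto intro!: derivative_eq_intros)
    qed
    then have "((\<lambda>t. \<Sum>i<n. partial_deriv i f (ray a x t) * (x i - a i)) has_integral f (ray a x 1) - f (ray a x 0)) {0..1}"
      using fundamental_theorem_of_calculus[of 0 1 "\<lambda>t. f (ray a x t)"]
      by (simp add: has_real_derivative_iff_has_vector_derivative has_vector_derivative_at_within)
    then have "f (ray a x 1) - f (ray a x 0) = integral (cbox 0 1) (\<lambda>t. \<Sum>i<n. partial_deriv i f (ray a x t) * (x i - a i))"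
      by (simp add: integral_unique)
    also have "\<dots> = (\<Sum>i<n. integral (cbox 0 1) (\<lambda>t. partial_deriv i f (ray a x t) * (x i - a i)))"
    proof (rule integral_sum)
      fix i assume "i \<in> {..<n}"
      then have i: "i < n" by simp
      show "(\<lambda>t. partial_deriv i f (ray a x t) * (x i - a i)) integrable_on cbox 0 1"
        using integrable_weighted_ray[OF V f'[OF i] star x, of 0] by (simp add: integrable_on_mult_left)
    qed simp
    also have "\<dots> = (\<Sum>i<n. (x i - a i) * g i x)"
      by (simp add: g_def mult.commute)
    finally show ?thesis
      by (simp add: ray_def)
  qed
  then show ?thesis
    using smooth g_a by (intro exI[of _ g]) simp
qed

section \<open>Composition with one-variable functions, and bump functions\<close>

lemma Ck_on_compose_real:
  fixes G :: "(real \<Rightarrow> real) set"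
  assumes V: "openin (Euclidean_space n) V"
    and G: "\<And>\<phi>. \<phi> \<in> G \<Longrightarrow> \<exists>\<phi>'\<in>G. \<forall>t\<in>S. (\<phi> has_field_derivative \<phi>' t) (at t)"
    and c: "Ck_on k n V c" "\<And>x. x \<in> V \<Longrightarrow> c x \<in> S" and "\<phi> \<in> G"
  shows "Ck_on k n V (\<lambda>x. \<phi> (c x))"
proof -
  have cont: "continuous_on V (\<lambda>x. \<phi> (c x))" if "\<phi> \<in> G" for \<phi>
  proof -
    obtain \<phi>' where "\<forall>t\<in>S. (\<phi> has_field_derivative \<phi>' t) (at t)"
      using G[OF \<open>\<phi> \<in> G\<close>] by blast
    then have "continuous_on S \<phi>"
      by (intro continuous_at_imp_continuous_on ballI) (blast intro: DERIV_isCont)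
    then show ?thesis
      by (rule continuous_on_compose2[OF _ Ck_on_continuous[OF V c(1)]]) (use c(2) in blast)
  qed
  show ?thesis
    using c(1) \<open>\<phi> \<in> G\<close>
  \<comment> \<open>\<open>G\<close> is closed under differentiation, so the induction hypothesis
    applies to the derivative of \<open>\<phi>\<close> as to \<open>\<phi>\<close> itself.\<close>
  proof (induction k arbitrary: \<phi>)
    case 0
    then show ?case
      using cont continuous_map_Euclidean_iff[OF openin_subset[OF V]] by simp
  next
    case (Suc k)
    obtain \<phi>' where \<phi>': "\<phi>' \<in> G" and D: "\<And>t. t \<in> S \<Longrightarrow> (\<phi> has_field_derivative \<phi>' t) (at t)"
      using G[OF Suc.prems(2)] by blast
    show ?case
    proof (rule Ck_on_SucI[OF V cont[OF Suc.prems(2)]])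
      fix i assume i: "i < n"
      show "Ck_on k n V (\<lambda>x. \<phi>' (c x) * partial_deriv i c x)"
        by (rule Ck_on_mult[OF V Suc.IH[OF Ck_on_Suc_D[OF Suc.prems(1)] \<phi>'] Ck_on_partial_deriv[OF Suc.prems(1) i]])
      fix x assume x: "x \<in> V"
      have "(\<phi> has_field_derivative \<phi>' (c x)) (at (c (x(i := x i))))"
        using D[OF c(2)[OF x]] by simp
      from DERIV_chain2[where g="\<lambda>t. c (x(i := t))", OF this Ck_on_DERIV[OF Suc.prems(1) i x]]
      show "((\<lambda>t. \<phi> (c (x(i := t)))) has_field_derivative \<phi>' (c x) * partial_deriv i c x) (at (x i))" .
    qed
  qed
qed

text \<open>On the positive reals the functions a * t^(-m) form a family closed under
  differentiation that contains 1/t.\<close>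

lemma Ck_on_inverse:
  assumes V: "openin (Euclidean_space n) V" and "Ck_on k n V c" "\<And>x. x \<in> V \<Longrightarrow> c x > 0"
  shows "Ck_on k n V (\<lambda>x. inverse (c x))"
proof (rule Ck_on_compose_real[OF V _ assms(2)])
  fix \<phi> :: "real \<Rightarrow> real" assume "\<phi> \<in> range (\<lambda>(a, m) t. a * inverse t ^ m)"
  then obtain a m where \<phi>: "\<phi> = (\<lambda>t. a * inverse t ^ m)"
    by auto
  have "(\<phi> has_field_derivative (- real m * a) * inverse t ^ Suc m) (at t)" if "t \<in> {0<..}" for t
  proof (cases m)
    case 0
    then show ?thesis by (simp add: \<phi>)
  next
    case (Suc l)
    then show ?thesis
      unfolding \<phi> using that DERIV_cmult[OF DERIV_power[OF DERIV_inverse[of t]], of a m]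
      by (simp add: algebra_simps numeral_2_eq_2)
  qed
  then show "\<exists>\<phi>'\<in>range (\<lambda>(a, m) t. a * inverse t ^ m).
      \<forall>t\<in>{0<..}. (\<phi> has_field_derivative \<phi>' t) (at t)"
    by (intro bexI[of _ "\<lambda>t. (- real m * a) * inverse t ^ Suc m"]) (auto intro!: image_eqI[of _ _ "(- real m * a, Suc m)"])
next
  show "inverse \<in> range (\<lambda>(a, m) (t::real). a * inverse t ^ m)"
    by (rule image_eqI[of _ _ "(1, 1)"]) auto
qed (use assms(3) in auto)

definition flat :: "real poly \<Rightarrow> real \<Rightarrow> real" where
  "flat p t = (if t > 0 then poly p (inverse t) * exp (- inverse t) else 0)"

lemma poly_exp_tendsto_0: "((\<lambda>s. poly q s * exp (- s)) \<longlongrightarrow> (0::real)) at_top"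
proof -
  have "((\<lambda>s. \<Sum>i\<le>degree q. coeff q i * (s ^ i / exp s)) \<longlongrightarrow> (\<Sum>i\<le>degree q. coeff q i * 0)) at_top"
    by (intro tendsto_sum tendsto_mult tendsto_const tendsto_power_div_exp_0)
  moreover have "(\<Sum>i\<le>degree q. coeff q i * (s ^ i / exp s)) = poly q s * exp (- s)" for s
    unfolding poly_altdef sum_distrib_right exp_minus divide_inverse by (simp add: mult.assoc)
  ultimately show ?thesis
    by simp
qed

text \<open>With s = 1/t one has ds/dt = -s^2, and the derivative of p(s) exp(-s) in s is (p' -
  p)(s) exp(-s); this is the origin of \<open>monom 1 2 * (p - pderiv p)\<close>. At 0 the
  exponential beats every polynomial.\<close>

lemma flat_DERIV: "(flat p has_field_derivative flat (monom 1 2 * (p - pderiv p)) t) (at t)"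
proof (cases t "0 :: real" rule: linorder_cases)
  case greater
  have "((\<lambda>t. poly p (inverse t) * exp (- inverse t)) has_field_derivative
      flat (monom 1 2 * (p - pderiv p)) t) (at t)"
    using greater
    by (auto simp: flat_def poly_monom power2_eq_square algebra_simps
        intro!: derivative_eq_intros DERIV_chain2[OF poly_DERIV])
  moreover have "\<forall>\<^sub>F u in nhds t. poly p (inverse u) * exp (- inverse u) = flat p u"
    by (rule eventually_mono[OF eventually_nhds_in_open[of "{0<..}" t]]) (use greater in \<open>auto simp: flat_def\<close>)
  ultimately show ?thesis
    using DERIV_cong_ev[OF refl _ refl, of "\<lambda>t. poly p (inverse t) * exp (- inverse t)" "flat p" t] by simp
next
  case less
  have "\<forall>\<^sub>F u in nhds t. 0 = flat p u"
    by (rule eventually_mono[OF eventually_nhds_in_open[of "{..<0}" t]]) (use less in \<open>auto simp: flat_def\<close>)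
  then have "((\<lambda>u. 0) has_field_derivative 0) (at t) \<longleftrightarrow> (flat p has_field_derivative 0) (at t)"
    by (rule DERIV_cong_ev[OF refl _ refl])
  then show ?thesis
    using less by (simp add: flat_def)
next
  case equal
  \<comment> \<open>Division by \<open>u\<close> multiplies the polynomial by its variable, which is
    \<open>pCons 0 p\<close>.\<close>
  have "((\<lambda>u. poly (pCons 0 p) (inverse u) * exp (- inverse u)) \<longlongrightarrow> 0) (at_right 0)"
    by (rule filterlim_compose[OF poly_exp_tendsto_0 filterlim_inverse_at_top_right])
  moreover have "\<forall>\<^sub>F u in at_right 0. poly (pCons 0 p) (inverse u) * exp (- inverse u) = flat p u / u"
    by (rule eventually_mono[OF eventually_at_right_less]) (simp add: flat_def field_simps)
  ultimately have right: "((\<lambda>u. flat p u / u) \<longlongrightarrow> 0) (at_right 0)"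
    by (rule Lim_transform_eventually)
  have "\<forall>\<^sub>F u in at_left (0::real). u < 0"
    by (auto simp: eventually_at_filter)
  then have "\<forall>\<^sub>F u in at_left 0. 0 = flat p u / u"
    by (rule eventually_mono) (simp add: flat_def)
  from Lim_transform_eventually[OF tendsto_const this]
  have left: "((\<lambda>u. flat p u / u) \<longlongrightarrow> 0) (at_left 0)" .
  show ?thesis
    using left right by (simp add: equal has_field_derivative_iff filterlim_at_split flat_def)
qed

lemma Ck_on_flat:
  assumes "openin (Euclidean_space n) V" "Ck_on k n V c"
  shows "Ck_on k n V (\<lambda>x. flat p (c x))"
  by (rule Ck_on_compose_real[where G="range flat" and S=UNIV, OF assms(1) _ assms(2)])
    (use flat_DERIV in blast)+

text \<open>Let \<rho> be the squared Euclidean distance from \<open>a\<close>. \<open>A\<close>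
  vanishes exactly for \<rho> \<ge> r^2 and \<open>B\<close> exactly for \<rho> \<le> r^2/2, so
  \<open>A + B\<close> is positive everywhere and the quotient A/(A + B) passes smoothly from 1 to
  0. Off the closed box a single coordinate already makes \<rho> at least r^2.\<close>

lemma bump_function:
  assumes a: "a \<in> topspace (Euclidean_space n)" and r: "r > 0"
  obtains b W where "smooth_on n (topspace (Euclidean_space n)) b"
    "openin (Euclidean_space n) W" "a \<in> W" "\<And>x. x \<in> W \<Longrightarrow> b x = 1"
    "\<And>x. x \<in> topspace (Euclidean_space n) \<Longrightarrow> x \<notin> closed_box n a r \<Longrightarrow> b x = 0"
proof -
  define E where "E = topspace (Euclidean_space n)"
  have E: "openin (Euclidean_space n) E"
    by (simp add: E_def)
  define \<rho> where "\<rho> = (\<lambda>x. \<Sum>i<n. (x i - a i) * (x i - a i))"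
  define A where "A = (\<lambda>x. flat 1 (r\<^sup>2 - \<rho> x))"
  define B where "B = (\<lambda>x. flat 1 (\<rho> x - r\<^sup>2 / 2))"
  define b where "b = (\<lambda>x. A x * inverse (A x + B x))"
  define W where "W = {x \<in> E. \<bar>\<rho> x - 0\<bar> < r\<^sup>2 / 2}"
  have \<rho>: "Ck_on k n E \<rho>" for k
    unfolding \<rho>_def by (intro Ck_on_sum Ck_on_mult Ck_on_diff Ck_on_coordinate Ck_on_const E)
  have pos: "flat 1 t > 0 \<longleftrightarrow> t > 0" "flat 1 t \<ge> 0" "flat 1 t = 0 \<longleftrightarrow> t \<le> 0" for t
    by (auto simp: flat_def)
  have r2: "r\<^sup>2 > 0" using r by simp
  have AB: "A x + B x > 0" for x
    using pos(1)[of "r\<^sup>2 - \<rho> x"] pos(1)[of "\<rho> x - r\<^sup>2 / 2"] pos(2)[of "r\<^sup>2 - \<rho> x"] pos(2)[of "\<rho> x - r\<^sup>2 / 2"] r2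
    unfolding A_def B_def by linarith
  have A: "Ck_on k n E A" and B: "Ck_on k n E B" for k
    unfolding A_def B_def
    by (rule Ck_on_flat[OF E Ck_on_diff[OF E Ck_on_const \<rho>]], rule Ck_on_flat[OF E Ck_on_diff[OF E \<rho> Ck_on_const]])
  have "Ck_on k n E b" for k
    unfolding b_def by (intro Ck_on_mult[OF E A] Ck_on_inverse[OF E] Ck_on_add[OF E A B] AB)
  then have 1: "smooth_on n E b"
    by (simp add: smooth_on_def)
  have 2: "openin (Euclidean_space n) W"
    unfolding W_def by (rule openin_Collect_dist_less[OF E Ck_on_continuous[OF E \<rho>[of 0]]])
  have 3: "a \<in> W"
    using a r2 by (simp add: W_def E_def \<rho>_def)
  have 4: "b x = 1" if "x \<in> W" for x
  proof -
    have "B x = 0"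
      using that by (auto simp: W_def B_def pos)
    then show ?thesis
      using AB[of x] by (simp add: b_def)
  qed
  have 5: "b x = 0" if x: "x \<in> E" "x \<notin> closed_box n a r" for x
  proof -
    obtain i where i: "i < n" "\<bar>x i - a i\<bar> > r"
      using x by (auto simp: closed_box_def E_def topspace_Euclidean_space not_le)
    have "r\<^sup>2 \<le> (x i - a i) * (x i - a i)"
      using i(2) r by (metis abs_le_square_iff abs_of_pos less_imp_le power2_eq_square)
    also have "\<dots> \<le> \<rho> x"
      unfolding \<rho>_def using i(1) by (intro member_le_sum) auto
    finally have "A x = 0"
      by (simp add: A_def pos)
    then show ?thesis
      by (simp add: b_def)
  qed
  show ?thesis
    using that[of b W] 1 2 3 4 5 unfolding E_def by blast
qed

section \<open>Tangent vectors in coordinates\<close>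

lemma smooth_on_subset: "smooth_on n V f \<Longrightarrow> V' \<subseteq> V \<Longrightarrow> smooth_on n V' f"
  unfolding smooth_on_def using Ck_on_subset by blast

lemma smooth_on_cong:
  assumes "openin (Euclidean_space n) V" "\<And>x. x \<in> V \<Longrightarrow> f x = g x" "smooth_on n V f"
  shows "smooth_on n V g"
  using assms(3) Ck_on_cong[OF assms(1), of f g] assms(2) unfolding smooth_on_def by blast

lemma smooth_on_mult:
  assumes "openin (Euclidean_space n) V" "smooth_on n V f" "smooth_on n V g"
  shows "smooth_on n V (\<lambda>x. f x * g x)"
  using assms(2,3) Ck_on_mult[OF assms(1)] unfolding smooth_on_def by blast

context
  fixes M :: "'a manifold" and U \<phi>
  assumes M: "smooth_manifold M" and U: "(U, \<phi>) \<in> atlas M"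
begin

lemma chart_open: "openin (mtop M) U"
  and chart_homeomorphic: "homeomorphic_map (subtopology (mtop M) U)
      (subtopology (Euclidean_space (mdim M)) (\<phi> ` U)) \<phi>"
  using M U unfolding smooth_manifold_def by (blast, blast)

lemma chart_subset: "U \<subseteq> mcarrier M"
  using chart_open by (rule openin_subset)

lemma chart_inj: "inj_on \<phi> U"
  using homeomorphic_imp_injective_map[OF chart_homeomorphic] chart_subset by (simp add: Int_absorb1)

lemma chart_inverse: "q \<in> U \<Longrightarrow> inv_into U \<phi> (\<phi> q) = q"
  using chart_inj by simp

lemma chart_image_open:
  assumes "openin (mtop M) A" "A \<subseteq> U"
  shows "openin (Euclidean_space (mdim M)) (\<phi> ` A)"
proof -
  have "openin (subtopology (mtop M) U) A"
    using assms chart_open by (simp add: openin_open_subtopology)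
  then have "openin (subtopology (Euclidean_space (mdim M)) (\<phi> ` U)) (\<phi> ` A)"
    using chart_homeomorphic homeomorphic_map_openness_eq by blast
  then show ?thesis
    using openin_trans_full Cinf_chart(1)[OF M U] by blast
qed

lemma chart_vimage_open:
  assumes "openin (Euclidean_space (mdim M)) B"
  shows "openin (mtop M) {q \<in> U. \<phi> q \<in> B}"
proof -
  have "continuous_map (subtopology (mtop M) U) (Euclidean_space (mdim M)) \<phi>"
    using homeomorphic_imp_continuous_map[OF chart_homeomorphic] continuous_map_in_subtopology by blast
  from openin_continuous_map_preimage[OF this assms]
  have "openin (subtopology (mtop M) U) {q \<in> U. \<phi> q \<in> B}"
    using chart_subset by (simp add: Int_absorb1)
  then show ?thesis
    using openin_trans_full chart_open by blast
qed

text \<open>A set closed in the image of a chart can fail to be closed in the manifold. Compactness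
  survives the inverse chart, and the Hausdorff property turns it into closedness.\<close>

lemma chart_vimage_closed:
  assumes "compactin (Euclidean_space (mdim M)) K" "K \<subseteq> \<phi> ` U"
  shows "closedin (mtop M) {q \<in> U. \<phi> q \<in> K}"
proof -
  obtain g where g: "homeomorphic_maps (subtopology (mtop M) U)
      (subtopology (Euclidean_space (mdim M)) (\<phi> ` U)) \<phi> g"
    using chart_homeomorphic homeomorphic_map_maps by blast
  then have "continuous_map (subtopology (Euclidean_space (mdim M)) (\<phi> ` U)) (mtop M) g"
    and g_\<phi>: "\<And>q. q \<in> U \<Longrightarrow> g (\<phi> q) = q"
    using chart_subset by (auto simp: homeomorphic_maps_def continuous_map_in_subtopology)
  moreover have "compactin (subtopology (Euclidean_space (mdim M)) (\<phi> ` U)) K"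
    using assms by (simp add: compactin_subtopology)
  ultimately have "compactin (mtop M) (g ` K)"
    using image_compactin by blast
  moreover have "g ` K = {q \<in> U. \<phi> q \<in> K}"
    using assms(2) g_\<phi> by (force simp: image_iff)
  ultimately show ?thesis
    using M compactin_imp_closedin unfolding smooth_manifold_def by metis
qed

end

section \<open>Extension of locally defined smooth functions by zero\<close>

context
  fixes M :: "'a manifold" and U \<phi>
  assumes M: "smooth_manifold M" and U: "(U, \<phi>) \<in> atlas M"
begin

text \<open>Any other chart domain is covered by two open sets: the part over \<open>B\<close>,
  where the function is \<open>h\<close> after a change of charts, and the complement of the closed
  set over \<open>K\<close>, where it is zero.\<close>

lemma Cinf_extend_by_zero:
  assumes B: "openin (Euclidean_space (mdim M)) B" "B \<subseteq> \<phi> ` U"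
    and K: "compactin (Euclidean_space (mdim M)) K" "K \<subseteq> B"
    and h: "smooth_on (mdim M) B h" "\<And>x. x \<in> B \<Longrightarrow> x \<notin> K \<Longrightarrow> h x = 0"
  shows "(\<lambda>q. if q \<in> U \<and> \<phi> q \<in> B then h (\<phi> q) else 0) \<in> Cinf M" (is "?F \<in> _")
proof -
  define n where "n = mdim M"
  have "smooth_on n (\<psi> ` V) (\<lambda>x. ?F (inv_into V \<psi> x))" if V: "(V, \<psi>) \<in> atlas M" for V \<psi>
    unfolding smooth_on_def
  proof
    fix k
    note chart' = chart_open[OF M V] chart_image_open[OF M V] chart_inverse[OF M V]
    define A1 where "A1 = V \<inter> {q \<in> U. \<phi> q \<in> B}"
    define A2 where "A2 = V - {q \<in> U. \<phi> q \<in> K}"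
    have A1: "openin (Euclidean_space n) (\<psi> ` A1)"
      unfolding A1_def n_def using chart'(1) chart_vimage_open[OF M U B(1)]
      by (intro chart'(2) openin_Int) auto
    have A2: "openin (Euclidean_space n) (\<psi> ` A2)"
      unfolding A2_def n_def using chart'(1) chart_vimage_closed[OF M U K(1)] K(2) B(2)
      by (intro chart'(2) openin_diff) auto
    have "Ck_on k n (\<psi> ` A1) (\<lambda>x. h (\<phi> (inv_into V \<psi> x)))"
    proof (rule Ck_on_compose[where V=B and n=n and h=h and \<tau>="\<lambda>x. \<phi> (inv_into V \<psi> x)", OF A1])
      show "openin (Euclidean_space n) B"
        using B(1) by (simp add: n_def)
      show "\<phi> (inv_into V \<psi> x) \<in> B" if "x \<in> \<psi> ` A1" for x
        using that chart'(3) by (auto simp: A1_def)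
      show "Ck_on k n (\<psi> ` A1) (\<lambda>x. \<phi> (inv_into V \<psi> x) j)" if "j < n" for j
      proof (rule Ck_on_subset)
        have "smooth_on n (\<psi> ` (V \<inter> U)) (\<lambda>x. \<phi> (inv_into V \<psi> x) j)"
          using M U V that unfolding smooth_manifold_def n_def by blast
        then show "Ck_on k n (\<psi> ` (V \<inter> U)) (\<lambda>x. \<phi> (inv_into V \<psi> x) j)"
          by (simp add: smooth_on_def)
      qed (auto simp: A1_def)
      show "Ck_on k n B h"
        using h(1) by (simp add: smooth_on_def n_def)
    qed
    then have 1: "Ck_on k n (\<psi> ` A1) (\<lambda>x. ?F (inv_into V \<psi> x))"
      by (rule Ck_on_cong[OF A1, rotated]) (auto simp: A1_def chart'(3))
    have 2: "Ck_on k n (\<psi> ` A2) (\<lambda>x. ?F (inv_into V \<psi> x))"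
      by (rule Ck_on_cong[OF A2 _ Ck_on_const[of _ _ _ 0]]) (use h(2) in \<open>fastforce simp: A2_def chart'(3)\<close>)
    have cover: "\<psi> ` V = \<psi> ` A1 \<union> \<psi> ` A2"
      using K(2) by (auto simp: A1_def A2_def)
    show "Ck_on k n (\<psi> ` V) (\<lambda>x. ?F (inv_into V \<psi> x))"
    proof (rule Ck_on_open_cover)
      show "openin (Euclidean_space n) (\<psi> ` V)"
        unfolding cover using A1 A2 by (rule openin_Un)
      show "\<exists>W. openin (Euclidean_space n) W \<and> x \<in> W \<and> Ck_on k n W (\<lambda>x. ?F (inv_into V \<psi> x))"
        if "x \<in> \<psi> ` V" for x
        using that 1 2 A1 A2 unfolding cover by blast
    qed
  qed
  moreover have "?F q = 0" if "q \<notin> mcarrier M" for q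
    using that chart_subset[OF M U] by auto
  ultimately show ?thesis
    by (auto simp: Cinf_def n_def)
qed

text \<open>\<open>B\<close> is an open box, hence star-shaped as Hadamard's lemma demands. The
  cutoff \<open>b\<close> vanishes off the closed box of half the radius, so its product with any
  smooth function on \<open>B\<close> has its support in a compact subset of
  \<open>B\<close>.\<close>

lemma local_extension:
  assumes p: "p \<in> U"
  obtains B b W where
    "openin (Euclidean_space (mdim M)) B" "\<phi> p \<in> B" "B \<subseteq> \<phi> ` U"
    "\<forall>x\<in>B. \<forall>t\<in>{0..1}. ray (\<phi> p) x t \<in> B"
    "\<forall>h. smooth_on (mdim M) B h \<longrightarrow>
      (\<lambda>q. if q \<in> U \<and> \<phi> q \<in> B then b (\<phi> q) * h (\<phi> q) else 0) \<in> Cinf M"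
    "openin (mtop M) W" "p \<in> W" "W \<subseteq> U" "\<phi> ` W \<subseteq> B" "\<forall>q\<in>W. b (\<phi> q) = 1"
proof -
  define n where "n = mdim M"
  have \<phi>U: "openin (Euclidean_space n) (\<phi> ` U)"
    using Cinf_chart(1)[OF M U] by (simp add: n_def)
  then obtain r where r: "r > 0" and rU: "open_box n (\<phi> p) r \<subseteq> \<phi> ` U"
    using open_box_subset p by blast
  have a: "\<phi> p \<in> topspace (Euclidean_space n)"
    using openin_subset[OF \<phi>U] p by blast
  define B where "B = open_box n (\<phi> p) r"
  define K where "K = closed_box n (\<phi> p) (r / 2)"
  have B: "openin (Euclidean_space n) B" "\<phi> p \<in> B"
    using r a by (auto simp: B_def openin_open_box, simp add: open_box_def topspace_Euclidean_space)
  have K: "compactin (Euclidean_space n) K" "K \<subseteq> B"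
    using r by (auto simp: B_def K_def compact_closed_box) (force simp: open_box_def closed_box_def)
  obtain b W where b: "smooth_on n (topspace (Euclidean_space n)) b"
    and W: "openin (Euclidean_space n) W" "\<phi> p \<in> W" "\<And>x. x \<in> W \<Longrightarrow> b x = 1"
    and b0: "\<And>x. x \<in> topspace (Euclidean_space n) \<Longrightarrow> x \<notin> K \<Longrightarrow> b x = 0"
    using bump_function[OF a, of "r / 2"] r unfolding K_def by (auto simp del: zero_less_divide_iff)
  show ?thesis
  proof
    show "openin (Euclidean_space (mdim M)) B" "\<phi> p \<in> B" "B \<subseteq> \<phi> ` U"
      using B rU by (auto simp: n_def B_def)
    show "\<forall>x\<in>B. \<forall>t\<in>{0..1}. ray (\<phi> p) x t \<in> B"
    proof (intro ballI)
      fix x and t :: real assume x: "x \<in> B" and t: "t \<in> {0..1}"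
      have "t * \<bar>x i - \<phi> p i\<bar> < r" if "i < n" for i
        using mult_right_mono[of t 1 "\<bar>x i - \<phi> p i\<bar>"] x t that
        by (force simp: B_def open_box_def)
      then show "ray (\<phi> p) x t \<in> B"
        using x t a by (auto simp: B_def open_box_def ray_def topspace_Euclidean_space abs_mult)
    qed
    have "(\<lambda>q. if q \<in> U \<and> \<phi> q \<in> B then b (\<phi> q) * h (\<phi> q) else 0) \<in> Cinf M"
      if h: "smooth_on (mdim M) B h" for h
    proof (rule Cinf_extend_by_zero[where K=K])
      have "B \<subseteq> topspace (Euclidean_space n)"
        using openin_subset[OF B(1)] .
      then show "smooth_on (mdim M) B (\<lambda>x. b x * h x)" "\<And>x. x \<in> B \<Longrightarrow> x \<notin> K \<Longrightarrow> b x * h x = 0"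
        using h smooth_on_subset[OF b] B(1) b0 by (auto simp: n_def intro!: smooth_on_mult)
    qed (use B K rU in \<open>auto simp: B_def n_def\<close>)
    then show "\<forall>h. smooth_on (mdim M) B h \<longrightarrow>
        (\<lambda>q. if q \<in> U \<and> \<phi> q \<in> B then b (\<phi> q) * h (\<phi> q) else 0) \<in> Cinf M"
      by blast
    show "openin (mtop M) {q \<in> U. \<phi> q \<in> W \<inter> B}"
      using W(1) B(1) by (intro chart_vimage_open[OF M U] openin_Int) (auto simp: n_def)
  qed (use p W B in auto)
qed

lemma partial_deriv_germ:
  assumes "openin (mtop M) W" "p \<in> W" "W \<subseteq> U" "\<And>q. q \<in> W \<Longrightarrow> F q = g (\<phi> q)" "i < mdim M"
  shows "partial_deriv i (\<lambda>x. F (inv_into U \<phi> x)) (\<phi> p) = partial_deriv i g (\<phi> p)"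
proof (rule partial_deriv_cong[OF chart_image_open[OF M U assms(1,3)]])
  show "F (inv_into U \<phi> x) = g x" if "x \<in> \<phi> ` W" for x
    using that assms(3,4) chart_inverse[OF M U] by auto
qed (use assms in auto)

end

lemma partial_deriv_coordinate: "partial_deriv j (\<lambda>x. x i) a = (if i = j then 1 else 0)"
  by (rule partial_derivI) simp

lemma tangent_spaceD:
  assumes "v \<in> tangent_space M p"
  shows "f \<in> Cinf M \<Longrightarrow> g \<in> Cinf M \<Longrightarrow> v (\<lambda>q. f q + g q) = v f + v g"
    and "f \<in> Cinf M \<Longrightarrow> v (\<lambda>q. c * f q) = c * v f"
    and "f \<in> Cinf M \<Longrightarrow> g \<in> Cinf M \<Longrightarrow> v (\<lambda>q. f q * g q) = v f * g p + f p * v g"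
  using assms unfolding tangent_space_def by simp_all

context
  fixes M :: "'a manifold"
  assumes M: "smooth_manifold M"
begin

lemma Cinf_sum:
  assumes "\<And>i. i < (k::nat) \<Longrightarrow> F i \<in> Cinf M"
  shows "(\<lambda>q. \<Sum>i<k. F i q) \<in> Cinf M"
  using assms
proof (induction k)
  case 0
  show ?case using Cinf_scaled_unit[OF M, of 0] by simp
next
  case (Suc k)
  then show ?case by (simp add: Cinf_add[OF M])
qed

lemma tangent_vector_sum:
  assumes v: "v \<in> tangent_space M p" and "\<And>i. i < (k::nat) \<Longrightarrow> F i \<in> Cinf M"
  shows "v (\<lambda>q. \<Sum>i<k. F i q) = (\<Sum>i<k. v (F i))"
  using assms(2)
proof (induction k)
  case 0
  show ?case
    using tangent_spaceD(2)[OF v unit_fun_Cinf[OF M], of 0] by simp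
next
  case (Suc k)
  then show ?case
    using tangent_spaceD(1)[OF v Cinf_sum] by simp
qed

context
  fixes U \<phi> p
  assumes U: "(U, \<phi>) \<in> atlas M" and p: "p \<in> U"
begin

text \<open>This existence gives meaning to the choice made in \<open>germ_apply\<close> for
  coordinate functions.\<close>

lemma local_coordinate_Cinf:
  "\<exists>f. f \<in> Cinf M \<and> (\<exists>W. openin (mtop M) W \<and> p \<in> W \<and> (\<forall>q\<in>W. f q = \<phi> q i))"
proof -
  obtain B b W where B: "openin (Euclidean_space (mdim M)) B" "\<phi> p \<in> B" "B \<subseteq> \<phi> ` U"
    and star: "\<forall>x\<in>B. \<forall>t\<in>{0..1}. ray (\<phi> p) x t \<in> B"
    and extend: "\<forall>h. smooth_on (mdim M) B h \<longrightarrow>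
      (\<lambda>q. if q \<in> U \<and> \<phi> q \<in> B then b (\<phi> q) * h (\<phi> q) else 0) \<in> Cinf M"
    and W: "openin (mtop M) W" "p \<in> W" "W \<subseteq> U" "\<phi> ` W \<subseteq> B" "\<forall>q\<in>W. b (\<phi> q) = 1"
    by (rule local_extension[OF M U p])
  have "smooth_on (mdim M) B (\<lambda>x. x i)"
    by (simp add: smooth_on_def Ck_on_coordinate[OF B(1)])
  then have "(\<lambda>q. if q \<in> U \<and> \<phi> q \<in> B then b (\<phi> q) * \<phi> q i else 0) \<in> Cinf M"
    using extend by blast
  moreover have "\<forall>q\<in>W. (if q \<in> U \<and> \<phi> q \<in> B then b (\<phi> q) * \<phi> q i else 0) = \<phi> q i"
    using W by auto
  ultimately show ?thesis
    using W(1,2) by (intro exI[of _ "\<lambda>q. if q \<in> U \<and> \<phi> q \<in> B then b (\<phi> q) * \<phi> q i else 0"]) blast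
qed

text \<open>The extension chosen by \<open>germ_apply\<close> is unknown away from \<open>p\<close>,
  but its partial derivatives at \<open>p\<close> are those of the coordinate, and a tangent vector
  will turn out to see only these.\<close>

lemma germ_apply_coordinate:
  obtains f where "germ_apply M (p, v) (\<lambda>q. \<phi> q i) = v f" "f \<in> Cinf M"
    "\<forall>j<mdim M. partial_deriv j (\<lambda>x. f (inv_into U \<phi> x)) (\<phi> p) = (if i = j then 1 else 0)"
proof -
  define f where "f = (SOME f. f \<in> Cinf M \<and> (\<exists>W. openin (mtop M) W \<and> p \<in> W \<and> (\<forall>q\<in>W. f q = \<phi> q i)))"
  have f: "f \<in> Cinf M \<and> (\<exists>W. openin (mtop M) W \<and> p \<in> W \<and> (\<forall>q\<in>W. f q = \<phi> q i))"
    unfolding f_def by (rule someI_ex[OF local_coordinate_Cinf])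
  then obtain W where W: "openin (mtop M) W" "p \<in> W" "\<forall>q\<in>W. f q = \<phi> q i"
    by blast
  have "partial_deriv j (\<lambda>x. f (inv_into U \<phi> x)) (\<phi> p) = (if i = j then 1 else 0)" if "j < mdim M" for j
    using partial_deriv_germ[OF M U openin_Int[OF W(1) chart_open[OF M U]], of p f "\<lambda>x. x i" j] W p that
    by (simp add: partial_deriv_coordinate)
  then show ?thesis
    using that[of f] f by (simp add: germ_apply_def f_def)
qed

text \<open>Hadamard's expansion of \<open>F\<close> holds only near \<open>p\<close>. Multiplied by
  the square of the cutoff \<open>\<beta>\<close> it becomes an identity of global functions, one
  factor \<open>\<beta>\<close> going to x_i - p_i and the other to the Hadamard coefficient. When
  \<open>v\<close> is applied, the unknown term \<open>F p * v (\<beta>\<^sup>2)\<close> appears on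
  both sides and cancels, and \<open>X i p = 0\<close> leaves only \<open>v (X i)\<close> times a
  partial derivative.\<close>

lemma tangent_vector_coordinates:
  assumes v: "v \<in> tangent_space M p" and f: "f \<in> Cinf M"
  shows "v f = (\<Sum>i<mdim M. germ_apply M (p, v) (\<lambda>q. \<phi> q i) *
    partial_deriv i (\<lambda>x. f (inv_into U \<phi> x)) (\<phi> p))"
proof -
  define n where "n = mdim M"
  obtain B b W where B: "openin (Euclidean_space (mdim M)) B" "\<phi> p \<in> B" "B \<subseteq> \<phi> ` U"
    and star: "\<forall>x\<in>B. \<forall>t\<in>{0..1}. ray (\<phi> p) x t \<in> B"
    and extend: "\<forall>h. smooth_on (mdim M) B h \<longrightarrow>
      (\<lambda>q. if q \<in> U \<and> \<phi> q \<in> B then b (\<phi> q) * h (\<phi> q) else 0) \<in> Cinf M"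
    and W: "openin (mtop M) W" "p \<in> W" "W \<subseteq> U" "\<phi> ` W \<subseteq> B" "\<forall>q\<in>W. b (\<phi> q) = 1"
    by (rule local_extension[OF M U p])
  define e where "e = (\<lambda>h q. if q \<in> U \<and> \<phi> q \<in> B then b (\<phi> q) * h (\<phi> q) else 0)"
  define X where "X = (\<lambda>i. e (\<lambda>x. x i - \<phi> p i))"
  define \<beta> where "\<beta> = e (\<lambda>x. 1)"
  have e: "smooth_on n B h \<Longrightarrow> e h \<in> Cinf M" for h
    using extend by (simp add: n_def e_def)
  have X: "X i \<in> Cinf M" for i
    unfolding X_def smooth_on_def
    by (intro e) (use B(1) in \<open>simp add: smooth_on_def n_def Ck_on_diff Ck_on_coordinate Ck_on_const\<close>)
  have \<beta>: "\<beta> \<in> Cinf M"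
    unfolding \<beta>_def by (intro e) (simp add: smooth_on_def Ck_on_const)
  have e_p: "e h p = h (\<phi> p)" for h
    using W p B(2) by (simp add: e_def)
  have main: "v F = (\<Sum>i<n. v (X i) * partial_deriv i (\<lambda>x. F (inv_into U \<phi> x)) (\<phi> p))"
    if F: "F \<in> Cinf M" for F
  proof -
    define F' where "F' = (\<lambda>x. F (inv_into U \<phi> x))"
    have F'\<phi>: "F' (\<phi> q) = F q" if "q \<in> U" for q
      using chart_inverse[OF M U that] by (simp add: F'_def)
    have "smooth_on n (\<phi> ` U) F'"
      using F U unfolding Cinf_def F'_def n_def by blast
    then have "smooth_on (mdim M) B F'"
      using smooth_on_subset B(3) unfolding n_def by blast
    from hadamard[OF B(1,2) star[rule_format] this]
    obtain g where g: "\<forall>i<n. smooth_on n B (g i) \<and> g i (\<phi> p) = partial_deriv i F' (\<phi> p)"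
      and F'_eq: "\<forall>x\<in>B. F' x = F' (\<phi> p) + (\<Sum>i<n. (x i - \<phi> p i) * g i x)"
      unfolding n_def by blast
    define G where "G = (\<lambda>i. e (g i))"
    have G: "G i \<in> Cinf M" "G i p = partial_deriv i F' (\<phi> p)" if "i < n" for i
      using g that e e_p by (auto simp: G_def)
    have \<beta>\<beta>: "(\<lambda>q. \<beta> q * \<beta> q) \<in> Cinf M"
      by (rule Cinf_mult[OF M \<beta> \<beta>])
    have XG: "(\<lambda>q. X i q * G i q) \<in> Cinf M" if "i < n" for i
      by (rule Cinf_mult[OF M X G(1)[OF that]])
    have "(\<beta> q * \<beta> q) * F q = F p * (\<beta> q * \<beta> q) + (\<Sum>i<n. X i q * G i q)" for q
    proof (cases "q \<in> U \<and> \<phi> q \<in> B")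
      case True
      then have "F q = F p + (\<Sum>i<n. (\<phi> q i - \<phi> p i) * g i (\<phi> q))"
        using F'_eq[rule_format, of "\<phi> q"] F'\<phi>[of q] F'\<phi>[OF p] by simp
      moreover have "(\<Sum>i<n. X i q * G i q) = (b (\<phi> q) * b (\<phi> q)) * (\<Sum>i<n. (\<phi> q i - \<phi> p i) * g i (\<phi> q))"
        using True by (simp add: X_def G_def e_def sum_distrib_left mult_ac)
      ultimately show ?thesis
        using True by (simp add: \<beta>_def e_def algebra_simps)
    qed (auto simp: \<beta>_def X_def G_def e_def intro!: sum.neutral)
    then have "v (\<lambda>q. (\<beta> q * \<beta> q) * F q) = v (\<lambda>q. F p * (\<beta> q * \<beta> q) + (\<Sum>i<n. X i q * G i q))"
      by (intro arg_cong[where f=v] ext)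
    moreover have "v (\<lambda>q. (\<beta> q * \<beta> q) * F q) = v (\<lambda>q. \<beta> q * \<beta> q) * F p + v F"
      using tangent_spaceD(3)[OF v \<beta>\<beta> F] e_p by (simp add: \<beta>_def)
    moreover have sum: "v (\<lambda>q. \<Sum>i<n. X i q * G i q) = (\<Sum>i<n. v (\<lambda>q. X i q * G i q))"
      by (rule tangent_vector_sum[OF v XG])
    moreover have "v (\<lambda>q. F p * (\<beta> q * \<beta> q) + (\<Sum>i<n. X i q * G i q)) =
        F p * v (\<lambda>q. \<beta> q * \<beta> q) + (\<Sum>i<n. v (\<lambda>q. X i q * G i q))"
      unfolding tangent_spaceD(2)[OF v \<beta>\<beta>, symmetric] sum[symmetric]
      by (rule tangent_spaceD(1)[OF v Cinf_cmult[OF M \<beta>\<beta>] Cinf_sum[OF XG]])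
    moreover have "(\<Sum>i<n. v (\<lambda>q. X i q * G i q)) = (\<Sum>i<n. v (X i) * partial_deriv i F' (\<phi> p))"
    proof (rule sum.cong)
      fix i assume "i \<in> {..<n}"
      then have i: "i < n" by simp
      have "X i p = 0"
        using e_p by (simp add: X_def)
      then show "v (\<lambda>q. X i q * G i q) = v (X i) * partial_deriv i F' (\<phi> p)"
        using tangent_spaceD(3)[OF v X G(1)[OF i], of i] G(2)[OF i] by simp
    qed simp
    ultimately show ?thesis
      by (simp add: F'_def mult.commute)
  qed
  \<comment> \<open>Apply the formula just proved to the extension chosen by
    \<open>germ_apply\<close>, whose partial derivatives are Kronecker deltas.\<close>
  have "germ_apply M (p, v) (\<lambda>q. \<phi> q i) = v (X i)" if i: "i < n" for i
  proof -
    obtain F where F: "germ_apply M (p, v) (\<lambda>q. \<phi> q i) = v F" "F \<in> Cinf M"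
      "\<forall>j<n. partial_deriv j (\<lambda>x. F (inv_into U \<phi> x)) (\<phi> p) = (if i = j then 1 else 0)"
      unfolding n_def by (rule germ_apply_coordinate)
    have "v F = (\<Sum>j<n. v (X j) * (if i = j then 1 else 0))"
      unfolding main[OF F(2)] using F(3) by simp
    also have "\<dots> = v (X i)"
      using i by (simp add: if_distrib[of "\<lambda>t. _ * t"] sum.delta cong: if_cong)
    finally show ?thesis
      using F(1) by simp
  qed
  then show ?thesis
    using main[OF f] by (simp add: n_def)
qed

text \<open>The vector is the sum of the \<open>y i\<close> times the partial derivatives at
  \<open>p\<close>. It makes the fibre coordinates of a tangent chart range over everything, so that
  the image of the chart is open.\<close>

lemma tangent_vector_with_coordinates:
  "\<exists>v\<in>tangent_space M p. \<forall>i<mdim M. germ_apply M (p, v) (\<lambda>q. \<phi> q i) = y i"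
proof -
  define n where "n = mdim M"
  define v where "v = (\<lambda>f. if f \<in> Cinf M
    then \<Sum>i<n. y i * partial_deriv i (\<lambda>x. f (inv_into U \<phi> x)) (\<phi> p) else 0)"
  have D: "((\<lambda>t. f (inv_into U \<phi> ((\<phi> p)(i := t)))) has_field_derivative
      partial_deriv i (\<lambda>x. f (inv_into U \<phi> x)) (\<phi> p)) (at (\<phi> p i))" if "f \<in> Cinf M" "i < n" for f i
  proof (rule Ck_on_DERIV[where V="\<phi> ` U" and k=0])
    show "Ck_on (Suc 0) n (\<phi> ` U) (\<lambda>x. f (inv_into U \<phi> x))"
      using that(1) U unfolding Cinf_def smooth_on_def n_def by blast
  qed (use that p in auto)
  note inv_p = chart_inverse[OF M U p]
  have add: "partial_deriv i (\<lambda>x. f (inv_into U \<phi> x) + g (inv_into U \<phi> x)) (\<phi> p) =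
      partial_deriv i (\<lambda>x. f (inv_into U \<phi> x)) (\<phi> p) + partial_deriv i (\<lambda>x. g (inv_into U \<phi> x)) (\<phi> p)"
    if "f \<in> Cinf M" "g \<in> Cinf M" "i < n" for f g i
    by (rule partial_derivI[OF DERIV_add[OF D[OF that(1,3)] D[OF that(2,3)]]])
  have cmult: "partial_deriv i (\<lambda>x. c * f (inv_into U \<phi> x)) (\<phi> p) =
      c * partial_deriv i (\<lambda>x. f (inv_into U \<phi> x)) (\<phi> p)" if "f \<in> Cinf M" "i < n" for f c i
    by (rule partial_derivI[OF DERIV_cmult[OF D[OF that]]])
  have mult: "partial_deriv i (\<lambda>x. f (inv_into U \<phi> x) * g (inv_into U \<phi> x)) (\<phi> p) =
      partial_deriv i (\<lambda>x. f (inv_into U \<phi> x)) (\<phi> p) * g p + partial_deriv i (\<lambda>x. g (inv_into U \<phi> x)) (\<phi> p) * f p"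
    if "f \<in> Cinf M" "g \<in> Cinf M" "i < n" for f g i
    using partial_derivI[OF DERIV_mult[OF D[OF that(1,3)] D[OF that(2,3)]]] inv_p by simp
  have "v \<in> tangent_space M p"
    unfolding tangent_space_def mem_Collect_eq
    by (auto simp: v_def Cinf_add[OF M] Cinf_cmult[OF M] Cinf_mult[OF M] add cmult mult
        sum.distrib sum_distrib_left sum_distrib_right algebra_simps)
  moreover have "germ_apply M (p, v) (\<lambda>q. \<phi> q i) = y i" if i: "i < n" for i
  proof -
    obtain F where F: "germ_apply M (p, v) (\<lambda>q. \<phi> q i) = v F" "F \<in> Cinf M"
      "\<forall>j<n. partial_deriv j (\<lambda>x. F (inv_into U \<phi> x)) (\<phi> p) = (if i = j then 1 else 0)"
      unfolding n_def by (rule germ_apply_coordinate)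
    have "v F = (\<Sum>j<n. y j * (if i = j then 1 else 0))"
      using F(2,3) by (simp add: v_def)
    also have "\<dots> = y i"
      using i by (simp add: if_distrib[of "\<lambda>t. _ * t"] sum.delta cong: if_cong)
    finally show ?thesis
      using F(1) by simp
  qed
  ultimately show ?thesis
    by (auto simp: n_def)
qed

end

end

section \<open>The tangent bundle and the Liouville field\<close>

text \<open>This is the bundle projection in coordinates. The zeros are filled in because a point of
  \<open>n\<close>-space is a sequence vanishing from index \<open>n\<close> on.\<close>

definition base_coords :: "nat \<Rightarrow> (nat \<Rightarrow> real) \<Rightarrow> nat \<Rightarrow> real" where
  "base_coords n z = (\<lambda>i. if i < n then z i else 0)"

lemma base_coords_upd: "i \<ge> n \<Longrightarrow> base_coords n (z(i := t)) = base_coords n z"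
  by (auto simp: base_coords_def)

lemma openin_base_coords_vimage:
  assumes "openin (Euclidean_space n) V"
  shows "openin (Euclidean_space m) {z \<in> topspace (Euclidean_space m). base_coords n z \<in> V}"
proof (rule openin_continuous_map_preimage[OF _ assms])
  have "continuous_map (Euclidean_space m) euclideanreal (\<lambda>z. z i)" for i
    by (simp add: Euclidean_space_eq continuous_on_coordinate)
  then show "continuous_map (Euclidean_space m) (Euclidean_space n) (base_coords n)"
    unfolding base_coords_def continuous_map_componentwise_Euclidean_space by blast
qed

lemma Ck_on_base_coords:
  assumes "openin (Euclidean_space n) V" "openin (Euclidean_space m) W"
    and "\<And>z. z \<in> W \<Longrightarrow> base_coords n z \<in> V" "Ck_on k n V f"
  shows "Ck_on k m W (\<lambda>z. f (base_coords n z))"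
  by (rule Ck_on_compose[OF assms(2,1,3) _ assms(4)])
    (simp_all add: base_coords_def Ck_on_coordinate[OF assms(2)])

context
  fixes M :: "'a manifold"
  assumes M: "smooth_manifold M"
begin

context
  fixes U \<phi> W \<Phi>
  assumes U: "(U, \<phi>) \<in> atlas M" and W\<Phi>: "tangent_chart M (U, \<phi>) = (W, \<Phi>)"
begin

lemma tangent_chart_domain: "(p, v) \<in> W \<longleftrightarrow> p \<in> U \<and> v \<in> tangent_space M p"
  using W\<Phi> chart_subset[OF M U] by (auto simp: tangent_chart_def tangent_vectors_def)

lemma tangent_chart_base:
  assumes "(p, v) \<in> W"
  shows "base_coords (mdim M) (\<Phi> (p, v)) = \<phi> p"
proof -
  have "\<phi> p i = 0" if "i \<ge> mdim M" for i
    using openin_Euclidean_space_subset[OF Cinf_chart(1)[OF M U] _ that] assms tangent_chart_domain by blast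
  then show ?thesis
    using W\<Phi> by (auto simp: tangent_chart_def base_coords_def not_less)
qed

lemma tangent_chart_fibre:
  "i < mdim M \<Longrightarrow> \<Phi> (p, v) (mdim M + i) = germ_apply M (p, v) (\<lambda>q. \<phi> q i)"
  using W\<Phi> by (auto simp: tangent_chart_def)

text \<open>Every tuple of fibre coordinates is attained over each base point, so the image is the
  whole cylinder over the image of the base chart.\<close>

lemma tangent_chart_image:
  "\<Phi> ` W = {z \<in> topspace (Euclidean_space (2 * mdim M)). base_coords (mdim M) z \<in> \<phi> ` U}"
proof (intro equalityI subsetI)
  fix z assume "z \<in> \<Phi> ` W"
  then obtain p v where "(p, v) \<in> W" "z = \<Phi> (p, v)"
    by auto
  then show "z \<in> {z \<in> topspace (Euclidean_space (2 * mdim M)). base_coords (mdim M) z \<in> \<phi> ` U}"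
    using W\<Phi> tangent_chart_base tangent_chart_domain
    by (auto simp: tangent_chart_def topspace_Euclidean_space)
next
  fix z assume "z \<in> {z \<in> topspace (Euclidean_space (2 * mdim M)). base_coords (mdim M) z \<in> \<phi> ` U}"
  then obtain p where z: "z \<in> topspace (Euclidean_space (2 * mdim M))"
    and p: "p \<in> U" "base_coords (mdim M) z = \<phi> p"
    by auto
  obtain v where v: "v \<in> tangent_space M p" "\<forall>i<mdim M. germ_apply M (p, v) (\<lambda>q. \<phi> q i) = z (mdim M + i)"
    using tangent_vector_with_coordinates[OF M U p(1), of "\<lambda>i. z (mdim M + i)"] by blast
  have W: "(p, v) \<in> W"
    using p(1) v(1) tangent_chart_domain by blast
  have "\<Phi> (p, v) i = z i" for i
  proof -
    consider "i < mdim M" | j where "i = mdim M + j" "j < mdim M" | "i \<ge> 2 * mdim M"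
      by (metis add_less_cancel_left le_add_diff_inverse mult_2 not_less)
    then show ?thesis
    proof cases
      case 1
      then show ?thesis
        using fun_cong[OF tangent_chart_base[OF W], of i] fun_cong[OF p(2), of i] by (simp add: base_coords_def)
    next
      case 2
      then show ?thesis
        using tangent_chart_fibre v(2) by simp
    next
      case 3
      then show ?thesis
        using W\<Phi> z by (auto simp: tangent_chart_def topspace_Euclidean_space)
    qed
  qed
  then show "z \<in> \<Phi> ` W"
    using W by (intro image_eqI[of _ _ "(p, v)"]) auto
qed

lemma tangent_chart_image_open: "openin (Euclidean_space (2 * mdim M)) (\<Phi> ` W)"
  unfolding tangent_chart_image by (rule openin_base_coords_vimage[OF Cinf_chart(1)[OF M U]])

end

lemma tangent_bundle_carrier: "mcarrier (tangent_bundle M) = tangent_vectors M"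
proof (intro equalityI subsetI)
  fix \<xi> assume "\<xi> \<in> mcarrier (tangent_bundle M)"
  then show "\<xi> \<in> tangent_vectors M"
    by (auto simp: tangent_bundle_def tangent_chart_def)
next
  fix \<xi> assume \<xi>: "\<xi> \<in> tangent_vectors M"
  then have "fst \<xi> \<in> mcarrier M"
    by (auto simp: tangent_vectors_def)
  then obtain U \<phi> where U: "(U, \<phi>) \<in> atlas M" "fst \<xi> \<in> U"
    using M unfolding smooth_manifold_def by blast
  obtain W \<Phi> where W\<Phi>: "tangent_chart M (U, \<phi>) = (W, \<Phi>)"
    by fastforce
  have "\<xi> \<in> W"
    using W\<Phi> U(2) \<xi> by (auto simp: tangent_chart_def)
  then have \<xi>W: "\<xi> \<in> {\<xi> \<in> W. \<Phi> \<xi> \<in> \<Phi> ` W}"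
    by blast
  have "(W, \<Phi>) \<in> tangent_chart M ` atlas M"
    using U(1) W\<Phi> by (metis image_eqI)
  then have "{\<xi> \<in> W. \<Phi> \<xi> \<in> \<Phi> ` W} \<in> {{\<xi> \<in> W. \<Phi> \<xi> \<in> Q} | W \<Phi> Q.
      (W, \<Phi>) \<in> tangent_chart M ` atlas M \<and> openin (Euclidean_space (2 * mdim M)) Q}"
    using tangent_chart_image_open[OF U(1) W\<Phi>] by blast
  then show "\<xi> \<in> mcarrier (tangent_bundle M)"
    using \<xi>W unfolding tangent_bundle_def manifold.simps topology_generated_by_topspace by (rule UnionI)
qed

text \<open>On its image \<open>\<Phi>\<close> undoes \<open>inv_into W \<Phi>\<close>, so any
  coordinate expression \<open>Q\<close> can stand in for the composite with the inverse
  chart.\<close>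

lemma tangent_bundle_CinfI:
  assumes "\<And>\<xi>. \<xi> \<notin> tangent_vectors M \<Longrightarrow> P \<xi> = 0"
    and "\<And>U \<phi> W \<Phi>. (U, \<phi>) \<in> atlas M \<Longrightarrow> tangent_chart M (U, \<phi>) = (W, \<Phi>) \<Longrightarrow>
      \<exists>Q. smooth_on (2 * mdim M) (\<Phi> ` W) Q \<and> (\<forall>\<xi>\<in>W. P \<xi> = Q (\<Phi> \<xi>))"
  shows "P \<in> Cinf (tangent_bundle M)"
proof -
  have "smooth_on (2 * mdim M) (\<Phi> ` W) (\<lambda>z. P (inv_into W \<Phi> z))"
    if U: "(U, \<phi>) \<in> atlas M" "tangent_chart M (U, \<phi>) = (W, \<Phi>)" for U \<phi> W \<Phi>
  proof -
    obtain Q where Q: "smooth_on (2 * mdim M) (\<Phi> ` W) Q" "\<forall>\<xi>\<in>W. P \<xi> = Q (\<Phi> \<xi>)"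
      using assms(2)[OF U] by blast
    show ?thesis
      by (rule smooth_on_cong[OF tangent_chart_image_open[OF U] _ Q(1)])
        (metis Q(2) f_inv_into_f inv_into_into)
  qed
  moreover have "atlas (tangent_bundle M) = tangent_chart M ` atlas M" "mdim (tangent_bundle M) = 2 * mdim M"
    by (simp_all add: tangent_bundle_def)
  ultimately show ?thesis
    using assms(1) unfolding Cinf_def tangent_bundle_carrier by fastforce
qed

lemma partial_deriv_tangent_chart:
  assumes U: "(U, \<phi>) \<in> atlas M" "tangent_chart M (U, \<phi>) = (W, \<Phi>)"
    and "\<forall>\<xi>\<in>W. P \<xi> = Q (\<Phi> \<xi>)" and "\<xi> \<in> W" "i < 2 * mdim M"
  shows "partial_deriv i (\<lambda>z. P (inv_into W \<Phi> z)) (\<Phi> \<xi>) = partial_deriv i Q (\<Phi> \<xi>)"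
proof (rule partial_deriv_cong[OF tangent_chart_image_open[OF U]])
  show "P (inv_into W \<Phi> z) = Q z" if "z \<in> \<Phi> ` W" for z
    using assms(3) that by (metis f_inv_into_f inv_into_into)
qed (use assms in auto)

section \<open>Lifts of functions to the tangent bundle and the Liouville field on them\<close>

lemma dual_lift_eq:
  assumes "f \<in> Cinf M"
  shows "dual_lift M f \<xi> = (if \<xi> \<in> tangent_vectors M then Dual (f (fst \<xi>)) (snd \<xi> f) else 0)"
  using assms by (auto simp: dual_lift_def tangent_to_weil_def split_beta)

context
  fixes f
  assumes f: "f \<in> Cinf M"
begin

context
  fixes U \<phi> W \<Phi>
  assumes U: "(U, \<phi>) \<in> atlas M" and W\<Phi>: "tangent_chart M (U, \<phi>) = (W, \<Phi>)"
begin

abbreviation (input) "local_rep \<equiv> \<lambda>x. f (inv_into U \<phi> x)"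
abbreviation (input) "re_rep \<equiv> \<lambda>z. local_rep (base_coords (mdim M) z)"
abbreviation (input) "eps_rep \<equiv> \<lambda>z. \<Sum>i<mdim M. z (mdim M + i) * partial_deriv i local_rep (base_coords (mdim M) z)"

lemma smooth_local_rep: "Ck_on k (mdim M) (\<phi> ` U) local_rep"
  using f U unfolding Cinf_def smooth_on_def by blast

lemma re_lift_chart:
  "smooth_on (2 * mdim M) (\<Phi> ` W) re_rep"
  "\<forall>\<xi>\<in>W. re_part (dual_lift M f \<xi>) = re_rep (\<Phi> \<xi>)"
proof -
  show "smooth_on (2 * mdim M) (\<Phi> ` W) re_rep"
    unfolding smooth_on_def
    by (intro allI Ck_on_base_coords[OF Cinf_chart(1)[OF M U] tangent_chart_image_open[OF U W\<Phi>]] smooth_local_rep)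
      (simp add: tangent_chart_image[OF U W\<Phi>])
  show "\<forall>\<xi>\<in>W. re_part (dual_lift M f \<xi>) = re_rep (\<Phi> \<xi>)"
  proof
    fix \<xi> assume \<xi>: "\<xi> \<in> W"
    obtain p v where [simp]: "\<xi> = (p, v)" by fastforce
    have "p \<in> U" "v \<in> tangent_space M p"
      using \<xi> tangent_chart_domain[OF U W\<Phi>] by auto
    then show "re_part (dual_lift M f \<xi>) = re_rep (\<Phi> \<xi>)"
      using \<xi> tangent_chart_base[OF U W\<Phi>] chart_inverse[OF M U] chart_subset[OF M U]
      by (auto simp: dual_lift_eq[OF f] tangent_vectors_def)
  qed
qed

lemma eps_lift_chart:
  "smooth_on (2 * mdim M) (\<Phi> ` W) eps_rep"
  "\<forall>\<xi>\<in>W. eps_part (dual_lift M f \<xi>) = eps_rep (\<Phi> \<xi>)"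
proof -
  note open' = tangent_chart_image_open[OF U W\<Phi>]
  show "smooth_on (2 * mdim M) (\<Phi> ` W) eps_rep"
    unfolding smooth_on_def
  proof (intro allI Ck_on_sum[OF open'] Ck_on_mult[OF open'] Ck_on_coordinate[OF open'])
    fix k i assume "i \<in> {..<mdim M}"
    then have "Ck_on k (mdim M) (\<phi> ` U) (partial_deriv i local_rep)"
      by (intro Ck_on_partial_deriv[OF smooth_local_rep]) simp
    then show "Ck_on k (2 * mdim M) (\<Phi> ` W) (\<lambda>z. partial_deriv i local_rep (base_coords (mdim M) z))"
      by (intro Ck_on_base_coords[OF Cinf_chart(1)[OF M U] open'])
        (simp_all add: tangent_chart_image[OF U W\<Phi>])
  qed
  show "\<forall>\<xi>\<in>W. eps_part (dual_lift M f \<xi>) = eps_rep (\<Phi> \<xi>)"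
  proof
    fix \<xi> assume \<xi>: "\<xi> \<in> W"
    obtain p v where [simp]: "\<xi> = (p, v)" by fastforce
    have p: "p \<in> U" and v: "v \<in> tangent_space M p"
      using \<xi> tangent_chart_domain[OF U W\<Phi>] by auto
    have "p \<in> mcarrier M"
      using p chart_subset[OF M U] by blast
    then have "eps_part (dual_lift M f \<xi>) = v f"
      using v by (simp add: dual_lift_eq[OF f] tangent_vectors_def)
    also have "\<dots> = eps_rep (\<Phi> \<xi>)"
      using \<xi> tangent_vector_coordinates[OF M U p v f] tangent_chart_base[OF U W\<Phi>]
        tangent_chart_fibre[OF U W\<Phi>] by simp
    finally show "eps_part (dual_lift M f \<xi>) = eps_rep (\<Phi> \<xi>)" .
  qed
qed

lemma partial_deriv_re_rep: "partial_deriv (mdim M + i) re_rep z = 0"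
  by (simp add: partial_deriv_def base_coords_upd)

text \<open>The expression is linear in the fibre coordinates, and its coefficients depend on the
  base coordinates only.\<close>

lemma partial_deriv_eps_rep:
  assumes i: "i < mdim M"
  shows "partial_deriv (mdim M + i) eps_rep z = partial_deriv i local_rep (base_coords (mdim M) z)"
proof (rule partial_derivI)
  define D where "D = (\<lambda>j. partial_deriv j local_rep (base_coords (mdim M) z))"
  have "((\<lambda>t. (z(mdim M + i := t)) (mdim M + j) * D j) has_field_derivative (if i = j then 1 else 0) * D j)
      (at (z (mdim M + i)))" for j
    by (cases "i = j") (auto intro!: derivative_eq_intros)
  then have "((\<lambda>t. \<Sum>j<mdim M. (z(mdim M + i := t)) (mdim M + j) * D j) has_field_derivative
      (\<Sum>j<mdim M. (if i = j then 1 else 0) * D j)) (at (z (mdim M + i)))"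
    by (rule DERIV_sum)
  also have "(\<Sum>j<mdim M. (if i = j then 1 else 0) * D j) = D i"
    using i by (simp add: if_distrib[of "\<lambda>t. t * _"] sum.delta cong: if_cong)
  finally show "((\<lambda>t. eps_rep (z(mdim M + i := t))) has_field_derivative
      partial_deriv i local_rep (base_coords (mdim M) z)) (at (z (mdim M + i)))"
    by (simp add: D_def base_coords_upd)
qed

end

text \<open>Membership here and in the next lemma rules out the default value 0 that
  \<open>liouville_field\<close> takes on other functions.\<close>

lemma re_lift_Cinf: "(\<lambda>\<xi>. re_part (dual_lift M f \<xi>)) \<in> Cinf (tangent_bundle M)"
proof (rule tangent_bundle_CinfI)
  show "\<exists>Q. smooth_on (2 * mdim M) (\<Phi> ` W) Q \<and> (\<forall>\<xi>\<in>W. re_part (dual_lift M f \<xi>) = Q (\<Phi> \<xi>))"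
    if "(U, \<phi>) \<in> atlas M" "tangent_chart M (U, \<phi>) = (W, \<Phi>)" for U \<phi> W \<Phi>
    using re_lift_chart[OF that] by (intro exI conjI)
qed (simp add: dual_lift_def zero_dual_def)

lemma eps_lift_Cinf: "(\<lambda>\<xi>. eps_part (dual_lift M f \<xi>)) \<in> Cinf (tangent_bundle M)"
proof (rule tangent_bundle_CinfI)
  show "\<exists>Q. smooth_on (2 * mdim M) (\<Phi> ` W) Q \<and> (\<forall>\<xi>\<in>W. eps_part (dual_lift M f \<xi>) = Q (\<Phi> \<xi>))"
    if "(U, \<phi>) \<in> atlas M" "tangent_chart M (U, \<phi>) = (W, \<Phi>)" for U \<phi> W \<Phi>
    using eps_lift_chart[OF that] by (intro exI conjI)
qed (simp add: dual_lift_def zero_dual_def)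

lemma liouville_field_lift:
  assumes \<xi>: "\<xi> \<in> tangent_vectors M"
  shows "liouville_field M (\<lambda>\<xi>. re_part (dual_lift M f \<xi>)) \<xi> = 0"
    and "liouville_field M (\<lambda>\<xi>. eps_part (dual_lift M f \<xi>)) \<xi> = snd \<xi> f"
proof -
  \<comment> \<open>This repeats the choice made in \<open>liouville_field\<close>; the computation
    relies only on its being an atlas chart around the base point.\<close>
  define c where "c = (SOME c. c \<in> atlas M \<and> fst \<xi> \<in> fst c)"
  obtain U \<phi> where c_eq: "c = (U, \<phi>)" by fastforce
  have "fst \<xi> \<in> mcarrier M"
    using \<xi> by (auto simp: tangent_vectors_def)
  then have "fst \<xi> \<in> (\<Union>(U, \<phi>)\<in>atlas M. U)"
    using M unfolding smooth_manifold_def by simp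
  then have "\<exists>c. c \<in> atlas M \<and> fst \<xi> \<in> fst c"
    by force
  then have "c \<in> atlas M \<and> fst \<xi> \<in> fst c"
    unfolding c_def by (rule someI_ex)
  then have U: "(U, \<phi>) \<in> atlas M" "fst \<xi> \<in> U"
    by (simp_all add: c_eq)
  obtain W \<Phi> where W\<Phi>: "tangent_chart M (U, \<phi>) = (W, \<Phi>)"
    by fastforce
  have W: "\<xi> \<in> W"
    using W\<Phi> U(2) \<xi> by (auto simp: tangent_chart_def)
  have liouville: "liouville_field M P \<xi> = (\<Sum>i<mdim M. \<Phi> \<xi> (mdim M + i) * partial_deriv (mdim M + i) Q (\<Phi> \<xi>))"
    if "P \<in> Cinf (tangent_bundle M)" "\<forall>\<xi>\<in>W. P \<xi> = Q (\<Phi> \<xi>)" for P Q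
    using that \<xi> partial_deriv_tangent_chart[OF U(1) W\<Phi> that(2) W]
    by (simp add: liouville_field_def c_def[symmetric] c_eq W\<Phi> Let_def)
  show "liouville_field M (\<lambda>\<xi>. re_part (dual_lift M f \<xi>)) \<xi> = 0"
    using liouville[OF re_lift_Cinf re_lift_chart(2)[OF U(1) W\<Phi>]] by (simp add: partial_deriv_re_rep[OF U(1) W\<Phi>])
  have "liouville_field M (\<lambda>\<xi>. eps_part (dual_lift M f \<xi>)) \<xi> = eps_part (dual_lift M f \<xi>)"
    using liouville[OF eps_lift_Cinf eps_lift_chart(2)[OF U(1) W\<Phi>]] eps_lift_chart(2)[OF U(1) W\<Phi>] W
    by (simp add: partial_deriv_eps_rep[OF U(1) W\<Phi>])
  then show "liouville_field M (\<lambda>\<xi>. eps_part (dual_lift M f \<xi>)) \<xi> = snd \<xi> f"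
    using \<xi> by (simp add: dual_lift_eq[OF f])
qed

end

lemma dual_form_liouville_field:
  "dual_form M (liouville_field M) =
    (\<lambda>f \<xi>. if f \<in> Cinf M \<and> \<xi> \<in> tangent_vectors M then Dual 0 (snd \<xi> f) else 0)"
  \<comment> \<open>Off the tangent vectors both components are the default 0 of
    \<open>liouville_field\<close>, and \<open>Dual 0 0\<close> is the zero of the algebra.\<close>
  by (auto simp: fun_eq_iff dual_form_def dual_form_vector_def liouville_field_lift)
    (simp add: liouville_field_def zero_dual_def)

end

section \<open>Derivations of the dual numbers and comparison of the two systems\<close>

lemma dual_derivation:
  assumes "\<delta> \<in> derivations"
  obtains c where "\<And>a. \<delta> a = Dual 0 (c * eps_part a)"
proof -
  define \<epsilon> where "\<epsilon> = Dual 0 1"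
  have lin: "linear \<delta>" and mult: "\<And>a b. \<delta> (a * b) = \<delta> a * b + a * \<delta> b"
    using assms by (auto simp: derivations_def)
  have "\<delta> 1 = 0"
    using mult[of 1 1] by simp
  have "\<epsilon> * \<epsilon> = 0"
    by (simp add: \<epsilon>_def times_dual_def zero_dual_def)
  \<comment> \<open>The left side equals \<open>\<epsilon>\<close> multiplied by twice the real part
    of \<open>\<delta> \<epsilon>\<close>.\<close>
  then have "\<delta> \<epsilon> * \<epsilon> + \<epsilon> * \<delta> \<epsilon> = 0"
    using mult[of \<epsilon> \<epsilon>] linear_0[OF lin] by simp
  then have re: "re_part (\<delta> \<epsilon>) = 0"
    by (simp add: \<epsilon>_def times_dual_def plus_dual_def zero_dual_def)
  have "\<delta> a = Dual 0 (eps_part (\<delta> \<epsilon>) * eps_part a)" for a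
  proof -
    have "a = re_part a *\<^sub>R 1 + eps_part a *\<^sub>R \<epsilon>"
      by (simp add: \<epsilon>_def scaleR_dual_def plus_dual_def one_dual_def dual.expand)
    then have "\<delta> a = re_part a *\<^sub>R \<delta> 1 + eps_part a *\<^sub>R \<delta> \<epsilon>"
      using linear_add[OF lin] linear_scale[OF lin] by metis
    then show ?thesis
      using re by (cases "\<delta> \<epsilon>") (simp add: \<open>\<delta> 1 = 0\<close> scaleR_dual_def plus_dual_def zero_dual_def mult.commute)
  qed
  then show ?thesis
    by (rule that)
qed

theorem proposition5:
  fixes M :: "'a manifold" and n r :: nat and d :: "nat \<Rightarrow> dual \<Rightarrow> dual"
  assumes "smooth_manifold M" and "paracompact_space (mtop M)" and "mdim M = n"
    and "derivation_basis r d"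
  shows "foliation_defined_by M {induced_field M (d i) | i. i < r} =
         foliation_defined_by M {dual_form M (liouville_field M)}"
proof -
  note M = assms(1)
  define C where "C = dual_form M (liouville_field M)"
  have "\<forall>i<r. d i \<in> derivations"
    using assms(4) by (simp add: derivation_basis_def)
  then have "\<forall>i<r. \<exists>c. \<forall>a. d i a = Dual 0 (c * eps_part a)"
    by (meson dual_derivation)
  then obtain c where c: "\<And>i a. i < r \<Longrightarrow> d i a = Dual 0 (c i * eps_part a)"
    by metis
  \<comment> \<open>This derivation fixes \<open>\<epsilon>\<close>. Since the \<open>d i\<close>
    span it, their constants \<open>c i\<close> cannot all be zero: otherwise its expansion would
    vanish at \<open>Dual 0 1\<close>.\<close>
  have "(\<lambda>a. Dual 0 (eps_part a)) \<in> derivations"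
    by (auto simp: derivations_def plus_dual_def scaleR_dual_def times_dual_def intro!: linearI)
  then obtain e where e: "\<And>a. Dual 0 (eps_part a) = (\<Sum>i<r. e i *\<^sub>R d i a)"
    using assms(4) unfolding derivation_basis_def by fast
  obtain k where k: "k < r" "c k \<noteq> 0"
  proof (rule ccontr)
    assume "\<not> thesis"
    then have "c i = 0" if "i < r" for i
      using that \<open>\<And>k. k < r \<Longrightarrow> c k \<noteq> 0 \<Longrightarrow> thesis\<close> by blast
    then have "(\<Sum>i<r. e i *\<^sub>R d i (Dual 0 1)) = 0"
      using c by (intro sum.neutral) (auto simp: scaleR_dual_def zero_dual_def)
    then show False
      using e[of "Dual 0 1"] by (simp add: zero_dual_def)
  qed
  \<comment> \<open>The sign is that of (-d) in the definition of the induced field.\<close>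
  have induced: "induced_field M (d i) = (\<lambda>f \<xi>. - c i *\<^sub>R C f \<xi>)" if "i < r" for i
    by (auto simp: fun_eq_iff induced_field_def C_def dual_form_liouville_field[OF M] c[OF that]
        dual_lift_eq[OF M] uminus_dual_def scaleR_dual_def zero_dual_def)
  \<comment> \<open>Submodules are closed under multiplication by elements of
    \<open>Cinf (tangent_bundle M)\<close>, which vanish off the carrier. The scalar
    \<open>s\<close> is therefore represented by \<open>s\<close> times the indicator of the
    carrier, which acts in the same way on a field that vanishes there too.\<close>
  have scale: "(\<lambda>f \<xi>. s *\<^sub>R X f \<xi>) \<in> S"
    if S: "field_submodule M S" "X \<in> S" and X: "\<And>f \<xi>. \<xi> \<notin> tangent_vectors M \<Longrightarrow> X f \<xi> = 0" for S X s
  proof -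
    have mult: "\<forall>h\<in>Cinf (tangent_bundle M). \<forall>X\<in>S. (\<lambda>f \<xi>. h \<xi> *\<^sub>R X f \<xi>) \<in> S"
      using S(1) by (simp add: field_submodule_def)
    have "(\<lambda>\<xi>. s * indicator (tangent_vectors M) \<xi>) \<in> Cinf (tangent_bundle M)"
    proof (rule tangent_bundle_CinfI[OF M])
      show "\<exists>Q. smooth_on (2 * mdim M) (\<Phi> ` W) Q \<and> (\<forall>\<xi>\<in>W. s * indicator (tangent_vectors M) \<xi> = Q (\<Phi> \<xi>))"
        if "tangent_chart M (U, \<phi>) = (W, \<Phi>)" for U \<phi> W \<Phi>
        using that by (intro exI[of _ "\<lambda>z. s"]) (auto simp: smooth_on_def Ck_on_const tangent_chart_def)
    qed simp
    from mult[rule_format, OF this S(2)]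
    have "(\<lambda>f \<xi>. (s * indicator (tangent_vectors M) \<xi>) *\<^sub>R X f \<xi>) \<in> S" .
    moreover have "(\<lambda>f \<xi>. (s * indicator (tangent_vectors M) \<xi>) *\<^sub>R X f \<xi>) = (\<lambda>f \<xi>. s *\<^sub>R X f \<xi>)"
      using X by (auto simp: fun_eq_iff indicator_def)
    ultimately show ?thesis by simp
  qed
  have C_off: "C f \<xi> = 0" if "\<xi> \<notin> tangent_vectors M" for f \<xi>
    using that by (simp add: C_def dual_form_liouville_field[OF M])
  \<comment> \<open>A differential system is the intersection of the submodules containing its
    generators, so it is enough that both sets of generators lie in the same submodules.\<close>
  have "{induced_field M (d i) | i. i < r} \<subseteq> S \<longleftrightarrow> {C} \<subseteq> S" if S: "field_submodule M S" for S
  proof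
    assume "{induced_field M (d i) | i. i < r} \<subseteq> S"
    then have "(\<lambda>f \<xi>. - c k *\<^sub>R C f \<xi>) \<in> S"
      using k(1) induced by auto
    then have "(\<lambda>f \<xi>. (- inverse (c k)) *\<^sub>R (- c k *\<^sub>R C f \<xi>)) \<in> S"
      by (rule scale[OF S]) (simp add: C_off)
    then show "{C} \<subseteq> S"
      using k(2) by simp
  next
    assume "{C} \<subseteq> S"
    then have "C \<in> S" by simp
    then have "(\<lambda>f \<xi>. - c i *\<^sub>R C f \<xi>) \<in> S" for i
      by (rule scale[OF S]) (rule C_off)
    then show "{induced_field M (d i) | i. i < r} \<subseteq> S"
      using induced by auto
  qed
  then have "differential_system M {induced_field M (d i) | i. i < r} = differential_system M {C}"
    unfolding differential_system_def hull_def by (intro arg_cong[where f=Inter]) auto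
  then show ?thesis
    by (simp add: foliation_defined_by_def C_def)
qed

end
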